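(* Let $n\in\mathbb{N}$, $n\ge 1$. Assume that for some $\alpha\in(0,1)$ and $\overline{C}\in[1,\infty)$ the function $\psi^*$ satisfies the weak upper scaling condition $$\psi^*(\lambda\theta)\le \overline{C}\,\lambda^{\alpha}\,\psi^*(\theta)\qquad\text{for all }\lambda\ge 1,\ \theta>1 .$$ If $f\in \mathcal{C}_0^{\beta}$ for some $\beta\in(n\alpha,1]$, then $$\lim_{t\to0^+} t^{-n}\left(P_t f-\sum_{k=0}^{n-1}\frac{t^k}{k!}\mathcal{L}^k f\right)=\frac{1}{n!}\mathcal{L}^n f ,$$ where the limit is taken in $\mathcal{C}_0(\mathbb{R}^d)$ with the supremum norm.
   Context: Let $d\in\mathbb{N}$, $d\geq 1$. Let $\nu$ be a Borel measure on $\mathbb{R}^d$ with $\nu(\{0\})=0$ and $\int_{\mathbb{R}^d}(1\wedge|z|)\,\nu(dz)<\infty$. Put $\psi(\xi)=\int_{\mathbb{R}^d}(1-e^{i\langle\xi,z\rangle})\,\nu(dz)$, $\xi\in\mathbb{R}^d$, and let $(p_t)_{t\ge0}$ be the convolution semigroup of probability measures on $\mathbb{R}^d$ with $\int_{\mathbb{R}^d}e^{i\langle\xi,x\rangle}p_t(dx)=e^{-t\psi(\xi)}$. Define $\psi^*(r)=\sup_{|\xi|\le r}\mathrm{Re}\,\psi(\xi)$ for $r>0$. $\mathcal{C}_0(\mathbb{R}^d)$ is the space of continuous functions $f:\mathbb{R}^d\to\mathbb{R}$ vanishing at infinity, with the supremum norm. $P_tf(x)=\int_{\mathbb{R}^d}f(x+y)\,p_t(dy)$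 defines a semigroup of operators on $\mathcal{C}_0(\mathbb{R}^d)$; $\mathcal{L}$ is its infinitesimal generator, $\mathcal{L}f=\lim_{t\to0^+}(P_tf-f)/t$, with domain $\mathcal{D}(\mathcal{L})$ the set of $f\in\mathcal{C}_0(\mathbb{R}^d)$ for which the limit exists in the supremum norm. $\mathcal{L}^k$ denotes the $k$-fold iterate, $\mathcal{L}^0f=f$. If $\int_{|y|<1}|y|^\beta\nu(dy)<\infty$ then for $f\in\mathcal{C}_0^\beta$ one has $\mathcal{L}f(x)=\int_{\mathbb{R}^d}(f(x+y)-f(x))\,\nu(dy)$. For $\beta\in(0,1]$, the H\"older space $\mathcal{C}_0^\beta$ is the set of $f\in\mathcal{C}_0(\mathbb{R}^d)$ with $\sup_{0<|x-y|\le1}\frac{|f(x)-f(y)|}{|x-y|^\beta}<\infty$. *)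

theory Defs
  imports "HOL-Probability.Probability"
begin

definition jump_measure :: "(real ^ 'd::finite) measure \<Rightarrow> bool" where
  "jump_measure \<nu> \<longleftrightarrow>
     sets \<nu> = sets borel \<and> emeasure \<nu> {0} = 0 \<and>
     (\<integral>\<^sup>+ z. ennreal (min 1 (norm z)) \<partial>\<nu>) < \<infinity>"

definition psi :: "(real ^ 'd::finite) measure \<Rightarrow> real ^ 'd \<Rightarrow> complex" where
  "psi \<nu> \<xi> = (\<integral> z. 1 - iexp (\<xi> \<bullet> z) \<partial>\<nu>)"

(* Under jump_measure, psi is bounded on balls, so the real-valued supremum is the true one. *)
definition psi_star :: "(real ^ 'd::finite) measure \<Rightarrow> real \<Rightarrow> real" where
  "psi_star \<nu> r = (SUP \<xi>\<in>{\<xi>. norm \<xi> \<le> r}. Re (psi \<nu> \<xi>))"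

(* Values p t with t < 0 are junk and unconstrained. *)
definition convolution_semigroup :: "(real \<Rightarrow> (real ^ 'd::finite) measure) \<Rightarrow> bool" where
  "convolution_semigroup p \<longleftrightarrow>
     (\<forall>t\<ge>0. prob_space (p t) \<and> sets (p t) = sets borel) \<and>
     p 0 = return borel 0 \<and>
     (\<forall>s\<ge>0. \<forall>t\<ge>0. p (s + t) = (p s \<star> p t)) \<and>
     (\<forall>g :: real ^ 'd \<Rightarrow> real. continuous_on UNIV g \<and> bounded (range g) \<longrightarrow>
        ((\<lambda>t. \<integral> x. g x \<partial>p t) \<longlongrightarrow> g 0) (at_right 0))"

definition C0 :: "(real ^ 'd::finite \<Rightarrow> real) set" where
  "C0 = {f. continuous_on UNIV f \<and> (f \<longlongrightarrow> 0) at_infinity}"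

definition C0_Holder :: "real \<Rightarrow> (real ^ 'd::finite \<Rightarrow> real) set" where
  "C0_Holder \<beta> = {f \<in> C0.
     bdd_above {\<bar>f x - f y\<bar> / norm (x - y) powr \<beta> | x y. 0 < norm (x - y) \<and> norm (x - y) \<le> 1}}"

definition semigroup_op ::
    "(real \<Rightarrow> (real ^ 'd::finite) measure) \<Rightarrow> real \<Rightarrow> (real ^ 'd \<Rightarrow> real) \<Rightarrow> real ^ 'd \<Rightarrow> real" where
  "semigroup_op p t f = (\<lambda>x. \<integral> y. f (x + y) \<partial>p t)"

(* Convergence in the supremum norm is uniform convergence on UNIV. *)
definition has_generator_limit ::
    "(real \<Rightarrow> (real ^ 'd::finite) measure) \<Rightarrow> (real ^ 'd \<Rightarrow> real) \<Rightarrow> (real ^ 'd \<Rightarrow> real) \<Rightarrow> bool" where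
  "has_generator_limit p f g \<longleftrightarrow> g \<in> C0 \<and>
     uniform_limit UNIV (\<lambda>t x. (semigroup_op p t f x - f x) / t) g (at_right 0)"

definition generator_domain ::
    "(real \<Rightarrow> (real ^ 'd::finite) measure) \<Rightarrow> (real ^ 'd \<Rightarrow> real) set" where
  "generator_domain p = {f \<in> C0. \<exists>g. has_generator_limit p f g}"

(* The limit is unique, so on generator_domain this is the limit; elsewhere it is junk. *)
definition generator_op ::
    "(real \<Rightarrow> (real ^ 'd::finite) measure) \<Rightarrow> (real ^ 'd \<Rightarrow> real) \<Rightarrow> real ^ 'd \<Rightarrow> real" where
  "generator_op p f = (THE g. has_generator_limit p f g)"

end

theory Submission
  imports Defs
begin

text \<open>
  Write \<open>\<rho>(z) = min 1 |z|\<close> and \<open>A g x = \<integral> (g (x + z) - g x) d\<nu>(z)\<close>. The expansion is Taylor's formula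
  for the curve \<open>t \<mapsto> P\<^sub>t f x\<close>, whose derivatives are \<open>P\<^sub>t (\<L>\<^sup>k f) x\<close>; the task is to show that \<open>f\<close> lies in
  the domain of \<open>\<L>\<^sup>n\<close>. This follows from two facts about a single application of the generator, valid
  whenever \<open>0 < c < b \<le> 1\<close> and \<open>\<integral> \<rho>\<^sup>c d\<nu> < \<infinity>\<close>:

  \<^item> \<open>A\<close> maps \<open>b\<close>-Hoelder functions in \<open>C0\<close> to \<open>(b - c)\<close>-Hoelder functions in \<open>C0\<close>: the second difference
    \<open>g (x + z) - g x - g (y + z) + g y\<close> is at most a constant times both \<open>\<rho>(z)\<^sup>b\<close> and \<open>\<rho>(x - y)\<^sup>b\<close>, hence
    times \<open>\<rho>(z)\<^sup>c \<rho>(x - y)\<^bsup>b-c\<^esup>\<close>, and the first factor is \<open>\<nu>\<close>-integrable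
    (\<open>levy_op_hoelder\<close>, \<open>levy_op_C0\<close>).
  \<^item> Such functions are in the domain of \<open>\<L>\<close>, and \<open>\<L> = A\<close> on them (\<open>generator_on_hoelder\<close>).

  The scaling condition gives \<open>\<integral> \<rho>\<^sup>c d\<nu> < \<infinity>\<close> for every \<open>c > \<alpha>\<close>: since \<open>1 - cos u \<ge> u\<^sup>2 / 4\<close> on \<open>[-1, 1]\<close>,
  the growth of \<open>\<psi>\<^sup>*\<close> controls the truncated second moments of \<open>\<nu>\<close>, and these are summed over dyadic
  shells (\<open>integrable_rho_powr\<close>). Choosing \<open>c\<close> strictly between \<open>\<alpha>\<close> and \<open>\<beta>/n\<close> allows \<open>n\<close> applications
  of \<open>A\<close>, each costing \<open>c\<close> of the Hoelder exponent.

  The measures \<open>\<nu>\<close> and \<open>p\<^sub>t\<close> are related only through their Fourier transforms, so \<open>\<L> = A\<close> is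
  first obtained for superpositions of characters \<open>x \<mapsto> e\<^bsup>i x \<bullet> \<xi>\<^esup>\<close>, where it is the derivative of
  \<open>e\<^bsup>-t\<psi>(\<xi>)\<^esup>\<close> at \<open>0\<close> (\<open>fourier_gen\<close>). A Hoelder function is then cut off and mollified with a Gaussian. The
  Gaussian is the characteristic function of a Gaussian measure, so the mollified functions are such
  superpositions, and their Hoelder constants stay bounded (\<open>fourier_approximation\<close>). The
  mean value theorem bounds \<open>|P\<^sub>t g x - g x - t A g x|\<close> by \<open>t sup\<^sub>s\<^sub>\<le>\<^sub>t \<parallel>P\<^sub>s A g - A g\<parallel>\<close>, and the supremum
  is controlled by the Hoelder constant and \<open>\<integral> \<rho>\<^bsup>b-c\<^esup> dp\<^sub>s\<close>, which tends to \<open>0\<close> with \<open>s\<close>. So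
  this bound survives the limit and yields uniform convergence of the difference quotients of the original function.
\<close>

section \<open>Bounded uniformly continuous functions\<close>

text \<open>
  The semigroup is studied on this space rather than on \<open>C0\<close>: membership follows from a Hoelder bound
  alone, so the approximating functions used later need no separate proof of decay at infinity.
\<close>

definition BUC :: "(real ^ 'd::finite \<Rightarrow> real) set" where
  "BUC = {f. bounded (range f) \<and> uniformly_continuous_on UNIV f}"

lemma BUC_bound:
  assumes "f \<in> BUC"
  obtains B where "B > 0" "\<And>x. \<bar>f x\<bar> \<le> B"
  using assms bounded_pos[of "range f"] unfolding BUC_def by auto

lemma BUC_measurable: "f \<in> BUC \<Longrightarrow> f \<in> borel_measurable borel"
  unfolding BUC_def
  by (auto intro: borel_measurable_continuous_onI uniformly_continuous_imp_continuous)

lemma BUC_modulus: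
  assumes "f \<in> BUC" "e > 0"
  obtains d where "d > 0" "\<And>x y. norm (x - y) < d \<Longrightarrow> \<bar>f x - f y\<bar> < e"
proof -
  from assms obtain d where "d > 0" "\<forall>x y. dist y x < d \<longrightarrow> dist (f y) (f x) < e"
    unfolding BUC_def uniformly_continuous_on_def by auto
  then show ?thesis by (intro that[of d]) (auto simp: dist_norm)
qed

lemma C0_subset_BUC: "C0 \<subseteq> BUC"
proof
  fix f :: "real ^ 'd \<Rightarrow> real"
  assume "f \<in> C0"
  then have cont: "continuous_on UNIV f"
    and decay: "\<And>e. e > 0 \<Longrightarrow> \<exists>b. \<forall>x. norm x \<ge> b \<longrightarrow> \<bar>f x\<bar> < e"
    by (auto simp: C0_def Lim_at_infinity dist_norm)
  have cont': "continuous_on S f" for S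
    using cont continuous_on_subset by blast
  obtain b where b: "\<And>x. norm x \<ge> b \<Longrightarrow> \<bar>f x\<bar> < 1"
    using decay[of 1] by auto
  have "bounded (f ` cball 0 b)"
    by (intro compact_imp_bounded compact_continuous_image cont') auto
  then obtain B where "\<forall>y \<in> f ` cball 0 b. norm y \<le> B"
    unfolding bounded_iff by blast
  then have B: "\<And>x. norm x \<le> b \<Longrightarrow> \<bar>f x\<bar> \<le> B" by simp
  have "\<bar>f x\<bar> \<le> max B 1" for x
    using b[of x] B[of x] by (cases "norm x \<le> b") auto
  then have bdd: "bounded (range f)"
    unfolding bounded_iff by (intro exI[of _ "max B 1"]) auto
  have "uniformly_continuous_on UNIV f"
    unfolding uniformly_continuous_on_def
  proof (intro allI impI)
    fix e :: real assume "e > 0"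
    then obtain c where c: "\<And>x. norm x \<ge> c \<Longrightarrow> \<bar>f x\<bar> < e / 2"
      using decay[of "e / 2"] by auto
    have "uniformly_continuous_on (cball 0 (c + 1)) f"
      by (intro compact_uniformly_continuous cont') auto
    then obtain d where d: "d > 0"
      "\<And>x y. norm x \<le> c + 1 \<Longrightarrow> norm y \<le> c + 1 \<Longrightarrow> dist y x < d \<Longrightarrow> dist (f y) (f x) < e"
      unfolding uniformly_continuous_on_def using \<open>e > 0\<close> by (auto simp: Ball_def)
    have "dist (f y) (f x) < e" if "dist y x < min d 1" for x y
    proof (cases "norm x \<le> c + 1 \<and> norm y \<le> c + 1")
      case True
      then show ?thesis using d that by auto
    next
      case False
      have "norm x \<le> norm y + dist y x" "norm y \<le> norm x + dist y x"
        by (metis add.commute dist_commute dist_norm norm_triangle_sub)+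
      with False that have "norm x \<ge> c" "norm y \<ge> c" by auto
      then show ?thesis using c[of x] c[of y] by (auto simp: dist_real_def)
    qed
    then show "\<exists>d>0. \<forall>x\<in>UNIV. \<forall>x'\<in>UNIV. dist x' x < d \<longrightarrow> dist (f x') (f x) < e"
      using d(1) by (intro exI[of _ "min d 1"]) auto
  qed
  with bdd show "f \<in> BUC" by (simp add: BUC_def)
qed

lemma BUC_linear:
  assumes "f \<in> BUC" "g \<in> BUC"
  shows "(\<lambda>x. f x + c * g x) \<in> BUC"
proof -
  have "bounded (range (\<lambda>x. f x + c * g x))"
  proof -
    obtain B1 B2 where "\<And>x. \<bar>f x\<bar> \<le> B1" "\<And>x. \<bar>g x\<bar> \<le> B2"
      using BUC_bound assms by metis
    then have "\<bar>f x + c * g x\<bar> \<le> B1 + \<bar>c\<bar> * B2" for x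
      using abs_triangle_ineq[of "f x" "c * g x"]
      by (intro order_trans[OF abs_triangle_ineq] add_mono) (auto simp: abs_mult intro: mult_left_mono)
    then show ?thesis unfolding bounded_iff by auto
  qed
  moreover have "uniformly_continuous_on UNIV (\<lambda>x. c * g x)"
    using assms(2) unfolding BUC_def
    by (auto intro: bounded_linear.uniformly_continuous_on[OF bounded_linear_mult_right])
  ultimately show ?thesis
    using assms unfolding BUC_def by (auto intro: uniformly_continuous_on_add)
qed

section \<open>The semigroup, its generator and Taylor expansion\<close>

locale conv_semigroup =
  fixes p :: "real \<Rightarrow> (real ^ 'd::finite) measure"
  assumes semigroup: "convolution_semigroup p"
begin

lemma prob_space_p: "t \<ge> 0 \<Longrightarrow> prob_space (p t)"
  and sets_p [measurable_cong]: "t \<ge> 0 \<Longrightarrow> sets (p t) = sets borel"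
  and p_0: "p 0 = return borel 0"
  and p_add: "s \<ge> 0 \<Longrightarrow> t \<ge> 0 \<Longrightarrow> p (s + t) = (p s \<star> p t)"
  using semigroup by (auto simp: convolution_semigroup_def)

lemma integrable_bounded:
  fixes h :: "real ^ 'd \<Rightarrow> 'b :: {banach, second_countable_topology}"
  assumes "t \<ge> 0" "h \<in> borel_measurable borel" "\<And>y. norm (h y) \<le> B"
  shows "integrable (p t) h"
proof -
  interpret prob_space "p t" using assms by (simp add: prob_space_p)
  have "h \<in> borel_measurable (p t)"
    using assms(2) measurable_cong_sets[OF sets_p[OF assms(1)] refl] by blast
  then show ?thesis
    using assms(3) by (intro integrable_const_bound[of _ B]) auto
qed

lemma integrable_shift:
  assumes "f \<in> BUC" "t \<ge> 0"
  shows "integrable (p t) (\<lambda>y. f (x + y))"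
proof -
  note [measurable] = BUC_measurable[OF assms(1)]
  obtain B where "\<And>x. \<bar>f x\<bar> \<le> B" using BUC_bound[OF assms(1)] by blast
  then show ?thesis using assms(2) by (intro integrable_bounded[where B = B]) auto
qed

lemma integrable_const_p: "t \<ge> 0 \<Longrightarrow> integrable (p t) (\<lambda>_. c :: real)"
  by (intro integrable_bounded[where B = "\<bar>c\<bar>"]) auto

lemma integrable_increment_p:
  "f \<in> BUC \<Longrightarrow> t \<ge> 0 \<Longrightarrow> integrable (p t) (\<lambda>y. f (x + y) - f x)"
  by (rule Bochner_Integration.integrable_diff[OF integrable_shift integrable_const_p])

lemma prob_p: "t \<ge> 0 \<Longrightarrow> measure (p t) (space (p t)) = 1"
  by (simp add: prob_space.prob_space prob_space_p)

lemma semigroup_op_0: "f \<in> BUC \<Longrightarrow> semigroup_op p 0 f x = f x"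
proof -
  assume "f \<in> BUC"
  note [measurable] = BUC_measurable[OF this]
  show ?thesis unfolding semigroup_op_def p_0 by (subst integral_return) auto
qed

lemma semigroup_op_linear:
  assumes "f \<in> BUC" "g \<in> BUC" "t \<ge> 0"
  shows "semigroup_op p t (\<lambda>x. f x + c * g x) x = semigroup_op p t f x + c * semigroup_op p t g x"
  using assms by (simp add: semigroup_op_def integrable_shift)

lemma semigroup_op_bound:
  assumes "f \<in> BUC" "t \<ge> 0" "\<And>x. \<bar>f x\<bar> \<le> e"
  shows "\<bar>semigroup_op p t f x\<bar> \<le> e"
proof -
  have "norm (\<integral>y. f (x + y) \<partial>p t) \<le> (\<integral>y. e \<partial>p t)"
    using assms by (intro Bochner_Integration.integral_norm_bound_integral integrable_shift integrable_const_p) auto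
  then show ?thesis by (simp add: semigroup_op_def prob_p assms(2))
qed

lemma semigroup_op_BUC:
  assumes "f \<in> BUC" "t \<ge> 0"
  shows "semigroup_op p t f \<in> BUC"
proof -
  obtain B where B: "\<And>x. \<bar>f x\<bar> \<le> B" using BUC_bound[OF assms(1)] by blast
  have "\<bar>semigroup_op p t f x\<bar> \<le> B" for x
    by (rule semigroup_op_bound[OF assms B])
  then have "bounded (range (semigroup_op p t f))" unfolding bounded_iff by auto
  moreover have "uniformly_continuous_on UNIV (semigroup_op p t f)"
    unfolding uniformly_continuous_on_def
  proof (intro allI impI)
    fix e :: real assume "e > 0"
    then obtain d where d: "d > 0" "\<And>x y. norm (x - y) < d \<Longrightarrow> \<bar>f x - f y\<bar> < e / 2"
      using BUC_modulus[OF assms(1), of "e / 2"] by auto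
    have "dist (semigroup_op p t f y) (semigroup_op p t f x) < e" if "dist y x < d" for x y
    proof -
      have *: "\<bar>f (y + z) - f (x + z)\<bar> \<le> e / 2" for z
        using d(2)[of "y + z" "x + z"] that by (auto simp: dist_norm)
      have "norm (\<integral>z. f (y + z) - f (x + z) \<partial>p t) \<le> (\<integral>z. e / 2 \<partial>p t)"
        using assms * by (intro Bochner_Integration.integral_norm_bound_integral
            Bochner_Integration.integrable_diff integrable_shift integrable_const_p) auto
      then show ?thesis using assms \<open>e > 0\<close>
        by (simp add: semigroup_op_def prob_p integrable_shift dist_real_def)
    qed
    then show "\<exists>d>0. \<forall>x\<in>UNIV. \<forall>x'\<in>UNIV. dist x' x < d \<longrightarrow>
        dist (semigroup_op p t f x') (semigroup_op p t f x) < e"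
      using d(1) by auto
  qed
  ultimately show ?thesis by (simp add: BUC_def)
qed

lemma semigroup_op_add:
  assumes "f \<in> BUC" "s \<ge> 0" "t \<ge> 0"
  shows "semigroup_op p (s + t) f x = semigroup_op p s (semigroup_op p t f) x"
proof -
  note [measurable] = BUC_measurable[OF assms(1)]
  note [measurable_cong] = sets_p[OF assms(2)] sets_p[OF assms(3)]
  interpret s: prob_space "p s" using assms by (simp add: prob_space_p)
  interpret t: prob_space "p t" using assms by (simp add: prob_space_p)
  interpret pair_prob_space "p s" "p t" ..
  obtain B where B: "\<And>x. \<bar>f x\<bar> \<le> B" using BUC_bound[OF assms(1)] by blast
  have "integrable (p s \<Otimes>\<^sub>M p t) (\<lambda>(y, z). f (x + (y + z)))"
    using B by (intro integrable_const_bound[of _ B]) auto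
  then have "(\<integral>w. f (x + w) \<partial>(p s \<star> p t)) = (\<integral>y. \<integral>z. f (x + (y + z)) \<partial>p t \<partial>p s)"
    unfolding convolution_def
    by (subst integral_distr) (auto simp: integral_fst'[symmetric] split_beta')
  then show ?thesis
    using assms by (simp add: semigroup_op_def p_add add.assoc)
qed

lemma continuous_at_0:
  fixes g :: "real ^ 'd \<Rightarrow> real"
  assumes "continuous_on UNIV g" "\<And>y. \<bar>g y\<bar> \<le> B"
  shows "((\<lambda>t. \<integral> x. g x \<partial>p t) \<longlongrightarrow> g 0) (at_right 0)"
proof -
  have "bounded (range g)" using assms(2) unfolding bounded_iff by auto
  then show ?thesis using semigroup assms(1) unfolding convolution_semigroup_def by blast
qed

text \<open>
  The increment \<open>f (x + y) - f x\<close> is small for small \<open>y\<close> and bounded for large \<open>y\<close>. Both cases are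
  dominated by \<open>e / 2 + 2 B w y\<close> with one bounded continuous weight \<open>w\<close> vanishing at \<open>0\<close>, to which the weak
  continuity of \<open>p\<close> applies, uniformly in \<open>x\<close>.
\<close>

lemma strongly_continuous:
  assumes "f \<in> BUC"
  shows "uniform_limit UNIV (\<lambda>t. semigroup_op p t f) f (at_right 0)"
proof (rule uniform_limitI)
  fix e :: real assume "e > 0"
  obtain B where B: "B > 0" "\<And>x. \<bar>f x\<bar> \<le> B" using BUC_bound[OF assms] by blast
  obtain d where d: "d > 0" "\<And>x y. norm (x - y) < d \<Longrightarrow> \<bar>f x - f y\<bar> < e / 2"
    using BUC_modulus[OF assms, of "e / 2"] \<open>e > 0\<close> by auto
  define w :: "real ^ 'd \<Rightarrow> real" where "w y = min 1 (norm y / d)" for y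
  have cont: "continuous_on UNIV w"
    unfolding w_def using d(1) by (intro continuous_intros) auto
  then have [measurable]: "w \<in> borel_measurable borel"
    by (rule borel_measurable_continuous_onI)
  have w: "0 \<le> w y" "w y \<le> 1" for y using d(1) by (auto simp: w_def)
  have "((\<lambda>t. \<integral> y. w y \<partial>p t) \<longlongrightarrow> w 0) (at_right 0)"
    by (rule continuous_at_0[OF cont, of 1]) (use w in auto)
  moreover have "w 0 < e / (4 * B)" using \<open>e > 0\<close> B d(1) by (simp add: w_def)
  ultimately have "eventually (\<lambda>t. (\<integral> y. w y \<partial>p t) < e / (4 * B)) (at_right 0)"
    by (rule order_tendstoD)
  moreover have "eventually (\<lambda>t::real. t > 0) (at_right 0)"
    by (rule eventually_at_right_less)
  ultimately show "eventually (\<lambda>t. \<forall>x\<in>UNIV. dist (semigroup_op p t f x) (f x) < e) (at_right 0)"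
  proof eventually_elim
    case (elim t)
    have bd: "\<bar>f (x + y) - f x\<bar> \<le> e / 2 + 2 * B * w y" for x y
    proof (cases "norm y < d")
      case True
      then show ?thesis using d(2)[of "x + y" x] w[of y] B
        by (smt (verit) add_diff_cancel_left' mult_nonneg_nonneg)
    next
      case False
      then have "w y = 1" using d(1) by (simp add: w_def)
      then show ?thesis using B(2)[of x] B(2)[of "x + y"] \<open>e > 0\<close> by simp
    qed
    have intw: "integrable (p t) w"
      using w elim by (intro integrable_bounded[where B = 1]) auto
    show ?case
    proof
      fix x
      have "norm (\<integral>y. f (x + y) - f x \<partial>p t) \<le> (\<integral>y. e / 2 + 2 * B * w y \<partial>p t)"
        using assms elim bd intw
        by (intro Bochner_Integration.integral_norm_bound_integral Bochner_Integration.integrable_add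
            Bochner_Integration.integrable_diff integrable_shift integrable_const_p integrable_mult_right) auto
      also have "\<dots> = e / 2 + 2 * B * (\<integral>y. w y \<partial>p t)"
        using elim intw by (simp add: prob_p integrable_const_p)
      also have "\<dots> < e"
        using elim B by (simp add: field_simps)
      finally show "dist (semigroup_op p t f x) (f x) < e"
        using assms elim by (simp add: semigroup_op_def prob_p integrable_const_p integrable_shift dist_real_def)
    qed
  qed
qed

text \<open>
  The graph of the generator on \<open>BUC\<close>, as a relation because the limit is always exhibited explicitly.
\<close>

definition gen :: "(real ^ 'd \<Rightarrow> real) \<Rightarrow> (real ^ 'd \<Rightarrow> real) \<Rightarrow> bool" where
  "gen f g \<longleftrightarrow> f \<in> BUC \<and> g \<in> BUC \<and>
     uniform_limit UNIV (\<lambda>t x. (semigroup_op p t f x - f x) / t) g (at_right 0)"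

lemma difference_quotient_bound:
  assumes "gen f g" "e > 0"
  shows "\<exists>d>0. \<forall>h x. 0 \<le> h \<longrightarrow> h < d \<longrightarrow> \<bar>semigroup_op p h f x - f x - h * g x\<bar> \<le> e * h"
proof -
  from assms have "eventually (\<lambda>t. \<forall>x. dist ((semigroup_op p t f x - f x) / t) (g x) < e) (at_right 0)"
    unfolding gen_def uniform_limit_iff by auto
  then obtain d where d: "d > 0"
    "\<And>t x. 0 < t \<Longrightarrow> t < d \<Longrightarrow> dist ((semigroup_op p t f x - f x) / t) (g x) < e"
    unfolding eventually_at_right_field by auto
  have "\<bar>semigroup_op p h f x - f x - h * g x\<bar> \<le> e * h" if "0 \<le> h" "h < d" for h x
  proof (cases "h = 0")
    case True
    then show ?thesis using assms by (simp add: semigroup_op_0 gen_def)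
  next
    case False
    then have h: "h > 0" using that by simp
    then have "semigroup_op p h f x - f x - h * g x = h * ((semigroup_op p h f x - f x) / h - g x)"
      by (simp add: field_simps)
    then show ?thesis using d(2)[OF h that(2), of x] h
      by (simp add: abs_mult dist_real_def)
  qed
  with d(1) show ?thesis by blast
qed

lemma strong_continuity_bound:
  assumes "f \<in> BUC" "e > 0"
  shows "\<exists>d>0. \<forall>h x. 0 \<le> h \<longrightarrow> h < d \<longrightarrow> \<bar>semigroup_op p h f x - f x\<bar> \<le> e"
proof -
  have "eventually (\<lambda>t. \<forall>x. dist (semigroup_op p t f x) (f x) < e) (at_right 0)"
    using strongly_continuous[OF assms(1)] assms(2) unfolding uniform_limit_iff by auto
  then obtain d where d: "d > 0"
    "\<And>t x. 0 < t \<Longrightarrow> t < d \<Longrightarrow> dist (semigroup_op p t f x) (f x) < e"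
    unfolding eventually_at_right_field by auto
  have "\<bar>semigroup_op p h f x - f x\<bar> \<le> e" if "0 \<le> h" "h < d" for h x
    using that d(2)[of h x] assms
    by (cases "h = 0") (auto simp: semigroup_op_0 dist_real_def intro: less_imp_le)
  with d(1) show ?thesis by blast
qed

text \<open>
  To the right of \<open>t\<close> the difference quotient is \<open>P\<^sub>t\<close> applied to that at \<open>0\<close>. To the left it is \<open>P\<^bsub>t-h\<^esub>\<close>
  applied to it, and strong continuity at \<open>g\<close> replaces \<open>P\<^bsub>t-h\<^esub> g\<close> by \<open>P\<^sub>t g\<close>. The two-sided derivative is
  what the mean value theorem requires.
\<close>

lemma semigroup_op_has_derivative:
  assumes "gen f g" "t \<ge> 0"
  shows "((\<lambda>s. semigroup_op p s f x) has_real_derivative semigroup_op p t g x) (at t within {0..})"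
  unfolding has_field_derivative_def has_derivative_within_alt
proof (intro conjI allI impI)
  show "bounded_linear ((*) (semigroup_op p t g x))"
    by (rule bounded_linear_mult_right)
next
  fix e :: real assume "e > 0"
  from assms have fg: "f \<in> BUC" "g \<in> BUC" by (auto simp: gen_def)
  obtain d1 where d1: "d1 > 0"
    "\<And>h x. 0 \<le> h \<Longrightarrow> h < d1 \<Longrightarrow> \<bar>semigroup_op p h f x - f x - h * g x\<bar> \<le> (e / 2) * h"
    using difference_quotient_bound[OF assms(1), of "e / 2"] \<open>e > 0\<close> by auto
  obtain d2 where d2: "d2 > 0"
    "\<And>h x. 0 \<le> h \<Longrightarrow> h < d2 \<Longrightarrow> \<bar>semigroup_op p h g x - g x\<bar> \<le> e / 2"
    using strong_continuity_bound[OF fg(2), of "e / 2"] \<open>e > 0\<close> by auto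
  \<comment> \<open>One estimate serves both sides: a step of length \<open>h\<close> starting at time \<open>r\<close>.\<close>
  have step: "\<bar>semigroup_op p (r + h) f x - semigroup_op p r f x - h * semigroup_op p r g x\<bar> \<le> (e / 2) * h"
    if "0 \<le> r" "0 \<le> h" "h < d1" for r h
  proof -
    let ?D = "\<lambda>x. (semigroup_op p h f x + (-1) * f x) + (- h) * g x"
    have D: "(\<lambda>x. semigroup_op p h f x + (-1) * f x) \<in> BUC"
      by (intro BUC_linear semigroup_op_BUC fg that)
    have "\<bar>semigroup_op p r ?D x\<bar> \<le> (e / 2) * h"
    proof (rule semigroup_op_bound[OF BUC_linear[OF D fg(2)] that(1)])
      show "\<bar>?D y\<bar> \<le> (e / 2) * h" for y
        using d1(2)[OF that(2,3), of y] by simp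
    qed
    also have "semigroup_op p r ?D x
        = semigroup_op p r (semigroup_op p h f) x - semigroup_op p r f x - h * semigroup_op p r g x"
      using that fg D semigroup_op_linear[OF D fg(2) that(1), of "-h"]
        semigroup_op_linear[OF semigroup_op_BUC[OF fg(1) that(2)] fg(1) that(1), of "-1"]
      by simp
    finally show ?thesis using that fg by (simp add: semigroup_op_add)
  qed
  have "norm (semigroup_op p s f x - semigroup_op p t f x - semigroup_op p t g x * (s - t)) \<le> e * norm (s - t)"
    if "s \<in> {0..}" "norm (s - t) < min d1 d2" for s
  proof (cases "t \<le> s")
    case True
    have "\<bar>semigroup_op p s f x - semigroup_op p t f x - (s - t) * semigroup_op p t g x\<bar> \<le> e / 2 * (s - t)"
      using step[of t "s - t"] assms(2) True that by auto
    also have "\<dots> \<le> e * norm (s - t)" using True \<open>e > 0\<close> by (auto simp: mult_right_mono)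
    finally show ?thesis by (simp add: mult.commute)
  next
    case False
    define h where "h = t - s"
    have h: "0 \<le> h" "h < d1" "h < d2" "t = s + h" "0 \<le> s"
      using False that by (auto simp: h_def)
    let ?E = "\<lambda>x. semigroup_op p h g x + (-1) * g x"
    have "\<bar>semigroup_op p s ?E x\<bar> \<le> e / 2"
    proof (rule semigroup_op_bound[OF BUC_linear[OF semigroup_op_BUC[OF fg(2) h(1)] fg(2)] h(5)])
      show "\<bar>?E y\<bar> \<le> e / 2" for y
        using d2(2)[OF h(1,3), of y] by simp
    qed
    also have "semigroup_op p s ?E x = semigroup_op p t g x - semigroup_op p s g x"
      using semigroup_op_linear[OF semigroup_op_BUC[OF fg(2) h(1)] fg(2) h(5), of "-1" x] h fg
      by (simp add: semigroup_op_add)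
    finally have "\<bar>semigroup_op p t g x - semigroup_op p s g x\<bar> \<le> e / 2" .
    from mult_left_mono[OF this h(1)]
    have "\<bar>h * (semigroup_op p t g x - semigroup_op p s g x)\<bar> \<le> e / 2 * h"
      using h(1) by (simp add: abs_mult mult.commute)
    moreover have "\<bar>semigroup_op p t f x - semigroup_op p s f x - h * semigroup_op p s g x\<bar> \<le> e / 2 * h"
      using step[of s h] h by simp
    ultimately have "\<bar>semigroup_op p s f x - semigroup_op p t f x + h * semigroup_op p t g x\<bar> \<le> e * h"
      unfolding right_diff_distrib by linarith
    then show ?thesis using h by (simp add: mult.commute)
  qed
  then show "\<exists>d>0. \<forall>y\<in>{0..}. norm (y - t) < d \<longrightarrow>
      norm (semigroup_op p y f x - semigroup_op p t f x - semigroup_op p t g x * (y - t)) \<le> e * norm (y - t)"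
    using d1(1) d2(1) by (intro exI[of _ "min d1 d2"]) auto
qed

text \<open>
  The comparison curve \<open>q\<close> will be a Taylor polynomial in time; the bound passes from the first
  derivative to the value by the mean value theorem.
\<close>

lemma semigroup_op_mvt:
  assumes "gen f g" "t > 0"
    and q: "\<And>s. 0 \<le> s \<Longrightarrow> s \<le> t \<Longrightarrow> (q has_real_derivative q' s) (at s)"
    and q0: "q 0 = f x"
    and bd: "\<And>s. 0 < s \<Longrightarrow> s < t \<Longrightarrow> \<bar>semigroup_op p s g x - q' s\<bar> \<le> c"
  shows "\<bar>semigroup_op p t f x - q t\<bar> \<le> c * t"
proof -
  let ?u = "\<lambda>s. semigroup_op p s f x - q s"
  have "(?u has_derivative (*) (semigroup_op p s g x - q' s)) (at s within {0..t})"
    if "0 \<le> s" "s \<le> t" for s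
    unfolding has_field_derivative_def[symmetric]
    using that q[of s] semigroup_op_has_derivative[OF assms(1), of s x]
    by (intro DERIV_diff) (auto intro: DERIV_subset)
  then obtain s where s: "s \<in> {0<..<t}" "?u t - ?u 0 = (semigroup_op p s g x - q' s) * (t - 0)"
    using mvt_simple[OF assms(2), of ?u "\<lambda>s. (*) (semigroup_op p s g x - q' s)"] by blast
  moreover have "?u 0 = 0" using assms by (simp add: semigroup_op_0 gen_def)
  ultimately have "\<bar>?u t\<bar> = \<bar>semigroup_op p s g x - q' s\<bar> * t"
    using assms(2) by (simp add: abs_mult)
  then show ?thesis using bd[of s] s(1) assms(2) by simp
qed

text \<open>
  Induction on the order: the derivative of the remainder of order \<open>n + 1\<close> of \<open>F 0\<close> is the remainder
  of order \<open>n\<close> of \<open>F 1\<close>, which is \<open>o(t\<^sup>n)\<close> uniformly in \<open>x\<close>.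
\<close>

lemma taylor_expansion:
  assumes "F 0 \<in> BUC" "\<And>k. k < n \<Longrightarrow> gen (F k) (F (Suc k))"
  shows "uniform_limit UNIV (\<lambda>t x. (semigroup_op p t (F 0) x - (\<Sum>k<n. t ^ k / fact k * F k x)) / t ^ n)
      (\<lambda>x. F n x / fact n) (at_right 0)"
  using assms
proof (induction n arbitrary: F)
  case 0
  then show ?case using strongly_continuous[of "F 0"] by simp
next
  case (Suc n)
  have gen0: "gen (F 0) (F 1)" using Suc.prems(2)[of 0] by simp
  have IH: "uniform_limit UNIV (\<lambda>t x. (semigroup_op p t (F 1) x - (\<Sum>k<n. t ^ k / fact k * F (Suc k) x)) / t ^ n)
      (\<lambda>x. F (Suc n) x / fact n) (at_right 0)"
    using Suc.IH[of "\<lambda>k. F (Suc k)"] Suc.prems(2) gen0 by (simp add: gen_def)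
  have rescale: "u - (v + c / m * w) = c * ((u - v) / c - w / m)" if "c \<noteq> 0" for u v w c m :: real
    unfolding right_diff_distrib using that by simp
  show ?case
  proof (rule uniform_limitI)
    fix e :: real assume "e > 0"
    then have "eventually (\<lambda>t. \<forall>x. dist ((semigroup_op p t (F 1) x
        - (\<Sum>k<n. t ^ k / fact k * F (Suc k) x)) / t ^ n) (F (Suc n) x / fact n) < e / 2) (at_right 0)"
      using IH[unfolded uniform_limit_iff, rule_format, of "e / 2"] by simp
    then obtain d where d: "d > 0" "\<And>t x. 0 < t \<Longrightarrow> t < d \<Longrightarrow> dist ((semigroup_op p t (F 1) x
        - (\<Sum>k<n. t ^ k / fact k * F (Suc k) x)) / t ^ n) (F (Suc n) x / fact n) < e / 2"
      unfolding eventually_at_right_field by auto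
    have "dist ((semigroup_op p t (F 0) x - (\<Sum>k<Suc n. t ^ k / fact k * F k x)) / t ^ Suc n)
        (F (Suc n) x / fact (Suc n)) < e" if t: "0 < t" "t < d" for t x
    proof -
      \<comment> \<open>The candidate leading term of the remainder is included in \<open>?q\<close>, so that its derivative \<open>?q'\<close>
          contains the limit supplied by the induction hypothesis.\<close>
      let ?q = "\<lambda>s. \<Sum>k<Suc (Suc n). s ^ k / fact k * F k x"
      let ?q' = "\<lambda>s. \<Sum>k<Suc n. s ^ k / fact k * F (Suc k) x"
      have "\<bar>semigroup_op p t (F 0) x - ?q t\<bar> \<le> (e / 2 * t ^ n) * t"
      proof (rule semigroup_op_mvt[OF gen0 t(1)])
        show "?q 0 = F 0 x" by (simp add: sum.lessThan_Suc_shift del: sum.lessThan_Suc)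
      next
        fix s
        have "((\<lambda>s. F 0 x + (\<Sum>k<Suc n. s ^ Suc k / fact (Suc k) * F (Suc k) x))
           has_real_derivative 0 + (\<Sum>k<Suc n. (real (Suc k) * s ^ k) / fact (Suc k) * F (Suc k) x)) (at s)"
          by (intro derivative_intros DERIV_cmult_right DERIV_cdivide) (rule derivative_eq_intros | simp)+
        moreover have "(real (Suc k) * s ^ k) / fact (Suc k) = s ^ k / fact k" for k
          by (simp add: field_simps del: of_nat_Suc)
        ultimately show "(?q has_real_derivative ?q' s) (at s)"
          by (simp only: sum.lessThan_Suc_shift[of _ "Suc n"]) simp
      next
        fix s assume s: "0 < s" "s < t"
        have "\<bar>semigroup_op p s (F 1) x - ?q' s\<bar>
          = s ^ n * dist ((semigroup_op p s (F 1) x - (\<Sum>k<n. s ^ k / fact k * F (Suc k) x)) / s ^ n)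
              (F (Suc n) x / fact n)"
        proof -
          have "semigroup_op p s (F 1) x - ?q' s = s ^ n * ((semigroup_op p s (F 1) x
              - (\<Sum>k<n. s ^ k / fact k * F (Suc k) x)) / s ^ n - F (Suc n) x / fact n)"
            using rescale[of "s ^ n"] s by (simp only: sum.lessThan_Suc[of _ n]) simp
          then show ?thesis using s by (simp add: abs_mult dist_real_def)
        qed
        also have "\<dots> \<le> t ^ n * (e / 2)"
          using s t d(2)[of s x] by (intro mult_mono power_mono) auto
        finally show "\<bar>semigroup_op p s (F 1) x - ?q' s\<bar> \<le> e / 2 * t ^ n"
          by (simp add: mult.commute)
      qed
      moreover have "semigroup_op p t (F 0) x - ?q t = t ^ Suc n *
          ((semigroup_op p t (F 0) x - (\<Sum>k<Suc n. t ^ k / fact k * F k x)) / t ^ Suc n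
           - F (Suc n) x / fact (Suc n))"
        using rescale[of "t ^ Suc n"] t by (simp only: sum.lessThan_Suc[of _ "Suc n"]) simp
      ultimately have "t ^ Suc n * dist ((semigroup_op p t (F 0) x
          - (\<Sum>k<Suc n. t ^ k / fact k * F k x)) / t ^ Suc n) (F (Suc n) x / fact (Suc n)) \<le> t ^ Suc n * (e / 2)"
        using t by (simp only: abs_mult dist_real_def) (simp add: mult_ac)
      then have "dist ((semigroup_op p t (F 0) x
          - (\<Sum>k<Suc n. t ^ k / fact k * F k x)) / t ^ Suc n) (F (Suc n) x / fact (Suc n)) \<le> e / 2"
        using t by (subst (asm) mult_le_cancel_left_pos) auto
      then show ?thesis using \<open>e > 0\<close> by linarith
    qed
    then show "eventually (\<lambda>t. \<forall>x\<in>UNIV. dist ((semigroup_op p t (F 0) x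
        - (\<Sum>k<Suc n. t ^ k / fact k * F k x)) / t ^ Suc n) (F (Suc n) x / fact (Suc n)) < e) (at_right 0)"
      using d(1) unfolding eventually_at_right_field by blast
  qed
qed

lemma generator_op_eq:
  assumes "has_generator_limit p f g"
  shows "generator_op p f = g"
  unfolding generator_op_def
proof (rule the_equality, rule assms)
  fix g' assume "has_generator_limit p f g'"
  then have "uniform_limit UNIV (\<lambda>t x. (semigroup_op p t f x - f x) / t) g' (at_right 0)"
    "uniform_limit UNIV (\<lambda>t x. (semigroup_op p t f x - f x) / t) g (at_right 0)"
    using assms by (auto simp: has_generator_limit_def)
  then have "((\<lambda>t. (semigroup_op p t f x - f x) / t) \<longlongrightarrow> g' x) (at_right 0)"
    "((\<lambda>t. (semigroup_op p t f x - f x) / t) \<longlongrightarrow> g x) (at_right 0)" for x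
    by (auto intro: tendsto_uniform_limitI)
  then show "g' = g" by (intro ext tendsto_unique[OF trivial_limit_at_right_real]) 
qed

lemma gen_if_has_generator_limit:
  assumes "f \<in> C0" "has_generator_limit p f g"
  shows "gen f g"
  using assms C0_subset_BUC by (auto simp: gen_def has_generator_limit_def)

end

section \<open>Hoelder functions\<close>

definition rho :: "real ^ 'd::finite \<Rightarrow> real" where
  "rho z = min 1 (norm z)"

text \<open>
  Since \<open>rho\<close> is truncated at \<open>1\<close>, the single constant \<open>K\<close> bounds the oscillation at distance at least \<open>1\<close>
  as well as the Hoelder quotient below, so no separate supremum norm has to be carried along.
\<close>

definition hoelder :: "real \<Rightarrow> real \<Rightarrow> (real ^ 'd::finite \<Rightarrow> real) \<Rightarrow> bool" where
  "hoelder K b g \<longleftrightarrow> 0 \<le> K \<and> (\<forall>x y. \<bar>g x - g y\<bar> \<le> K * rho (x - y) powr b)"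

lemma rho_nonneg [simp]: "0 \<le> rho z" and rho_le_1 [simp]: "rho z \<le> 1"
  and rho_0 [simp]: "rho 0 = 0"
  by (auto simp: rho_def)

lemma rho_pos: "z \<noteq> 0 \<Longrightarrow> 0 < rho z"
  by (simp add: rho_def)

lemma continuous_rho: "continuous_on UNIV rho"
  unfolding rho_def by (intro continuous_intros)

lemma rho_measurable [measurable]: "rho \<in> borel_measurable borel"
  using continuous_rho by (rule borel_measurable_continuous_onI)

lemma continuous_rho_powr: "0 < b \<Longrightarrow> continuous_on UNIV (\<lambda>z. rho z powr b)"
  by (intro continuous_on_powr' continuous_rho continuous_intros) auto

lemma rho_powr_le_1: "0 \<le> b \<Longrightarrow> rho z powr b \<le> 1"
  by (rule powr_le1) auto

lemma rho_powr_antimono: "a \<le> b \<Longrightarrow> rho z powr b \<le> rho z powr a"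
  by (cases "z = 0") (auto intro: powr_mono' rho_pos)

lemma hoelder_BUC:
  assumes "hoelder K b g" "0 < b"
  shows "g \<in> BUC"
proof -
  have bd: "\<bar>g x - g y\<bar> \<le> K * rho (x - y) powr b" and K: "0 \<le> K" for x y
    using assms by (auto simp: hoelder_def)
  have "\<bar>g x\<bar> \<le> \<bar>g 0\<bar> + K" for x
    using bd[of x 0] mult_left_mono[OF rho_powr_le_1[of b x] K] assms(2) by auto
  then have "bounded (range g)" unfolding bounded_iff by auto
  moreover have "uniformly_continuous_on UNIV g"
    unfolding uniformly_continuous_on_def
  proof (intro allI impI)
    fix e :: real assume "e > 0"
    have "continuous_on UNIV (\<lambda>z :: real ^ 'a. K * rho z powr b)"
      by (intro continuous_intros continuous_rho_powr assms)
    from this[unfolded continuous_on_iff, rule_format, OF UNIV_I \<open>e > 0\<close>, of 0]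
    obtain d where "d > 0" "\<And>z :: real ^ 'a. dist z 0 < d \<Longrightarrow> dist (K * rho z powr b) (K * rho 0 powr b) < e"
      by auto
    then have d: "d > 0" "\<And>z :: real ^ 'a. norm z < d \<Longrightarrow> K * rho z powr b < e"
      using K by (auto simp: dist_real_def)
    have "dist (g y) (g x) < e" if "dist y x < d" for x y
      using d(2)[of "y - x"] bd[of y x] that by (simp add: dist_norm)
    then show "\<exists>d>0. \<forall>x\<in>UNIV. \<forall>x'\<in>UNIV. dist x' x < d \<longrightarrow> dist (g x') (g x) < e"
      using d(1) by auto
  qed
  ultimately show ?thesis by (simp add: BUC_def)
qed

lemma C0_Holder_imp_hoelder:
  assumes "f \<in> C0_Holder b" "0 < b"
  obtains K where "hoelder K b f"
proof -
  have "f \<in> C0" using assms by (simp add: C0_Holder_def)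
  then obtain B where B: "B > 0" "\<And>x. \<bar>f x\<bar> \<le> B"
    using BUC_bound C0_subset_BUC by (metis subsetD)
  from assms(1) obtain H where
    "\<And>q. q \<in> {\<bar>f x - f y\<bar> / norm (x - y) powr b | x y. 0 < norm (x - y) \<and> norm (x - y) \<le> 1} \<Longrightarrow> q \<le> H"
    unfolding C0_Holder_def bdd_above_def by auto
  then have H: "\<bar>f x - f y\<bar> / norm (x - y) powr b \<le> H" if "0 < norm (x - y)" "norm (x - y) \<le> 1" for x y
    using that by blast
  have "\<bar>f x - f y\<bar> \<le> max H (2 * B) * rho (x - y) powr b" for x y
  proof (cases "x = y \<or> norm (x - y) > 1")
    case True
    then show ?thesis using B(2)[of x] B(2)[of y] by (auto simp: rho_def)
  next
    case False
    then have n: "0 < norm (x - y)" "norm (x - y) \<le> 1" by auto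
    have "\<bar>f x - f y\<bar> \<le> H * norm (x - y) powr b"
      using H[OF n] n by (simp add: field_simps)
    also have "\<dots> \<le> max H (2 * B) * norm (x - y) powr b"
      by (intro mult_right_mono) auto
    finally show ?thesis using n by (simp add: rho_def)
  qed
  then show ?thesis using that[of "max H (2 * B)"] B(1) by (auto simp: hoelder_def)
qed

section \<open>The jump measure and its nonlocal operator\<close>

definition levy_op :: "(real ^ 'd::finite) measure \<Rightarrow> (real ^ 'd \<Rightarrow> real) \<Rightarrow> real ^ 'd \<Rightarrow> real" where
  "levy_op \<nu> g x = (\<integral>z. g (x + z) - g x \<partial>\<nu>)"

lemma norm_iexp_minus_1: "cmod (iexp u - 1) \<le> \<bar>u\<bar>" "cmod (iexp u - 1) \<le> 2"
  using iexp_approx1[of u 0] norm_triangle_ineq4[of "iexp u" 1] by simp_all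

lemma iexp_bound: "cmod (1 - iexp (\<xi> \<bullet> z)) \<le> (2 + norm \<xi>) * rho z"
proof -
  have "\<bar>\<xi> \<bullet> z\<bar> \<le> norm \<xi> * norm z" by (rule Cauchy_Schwarz_ineq2)
  then have *: "cmod (1 - iexp (\<xi> \<bullet> z)) \<le> norm \<xi> * norm z" "cmod (1 - iexp (\<xi> \<bullet> z)) \<le> 2"
    using norm_iexp_minus_1[of "\<xi> \<bullet> z"] unfolding norm_minus_commute[of 1] by linarith+
  show ?thesis
  proof (cases "norm z \<le> 1")
    case True
    then have "rho z = norm z" by (simp add: rho_def)
    then show ?thesis using *(1) norm_ge_zero[of z] by (simp only: distrib_right)
  next
    case False
    then have "rho z = 1" by (simp add: rho_def)
    then show ?thesis using *(2) norm_ge_zero[of \<xi>] by (simp only: mult_1_right)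
  qed
qed

text \<open>
  The third-order Taylor error of \<open>cos\<close> is at most \<open>|u|\<^sup>3 / 6 \<le> u\<^sup>2 / 6\<close>, which leaves
  \<open>u\<^sup>2 / 3 \<ge> u\<^sup>2 / 4\<close>.
\<close>

lemma one_minus_cos_ge: "u\<^sup>2 / 4 \<le> 1 - cos u" if "\<bar>u\<bar> \<le> 1" for u :: real
proof -
  have "cmod (iexp u - (\<Sum>k\<le>2. (\<i> * u)^k / fact k)) \<le> \<bar>u\<bar>^3 / 6"
    using iexp_approx1[of u 2] by (simp add: numeral_eq_Suc fact_numeral)
  then have "\<bar>Re (iexp u - (\<Sum>k\<le>2. (\<i> * u)^k / fact k))\<bar> \<le> \<bar>u\<bar>^3 / 6"
    using abs_Re_le_cmod order_trans by blast
  moreover have "Re (iexp u - (\<Sum>k\<le>2. (\<i> * u)^k / fact k)) = cos u - 1 + u\<^sup>2 / 2"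
    by (simp add: numeral_2_eq_2 Re_exp power_mult_distrib)
  moreover have "\<bar>u\<bar>^3 \<le> u\<^sup>2 * 1"
    using that mult_left_mono[OF that, of "u\<^sup>2"] by (simp add: power3_eq_cube power2_eq_square abs_mult mult.assoc)
  moreover have "0 \<le> u\<^sup>2" by simp
  ultimately show ?thesis by linarith
qed

text \<open>
  The smaller of \<open>a\<^sup>b\<close> and \<open>d\<^sup>b\<close> lies below every geometric mean of the two.
\<close>

lemma powr_interpolation:
  fixes a d :: real
  assumes "0 \<le> a" "0 \<le> d" "0 \<le> c" "c \<le> b" "u \<le> a powr b" "u \<le> d powr b"
  shows "u \<le> a powr c * d powr (b - c)"
proof (cases "a \<le> d")
  case True
  have "u \<le> a powr c * a powr (b - c)" using assms by (simp add: powr_add[symmetric])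
  also have "\<dots> \<le> a powr c * d powr (b - c)"
    using True assms by (intro mult_left_mono powr_mono2) auto
  finally show ?thesis .
next
  case False
  have "u \<le> d powr c * d powr (b - c)" using assms by (simp add: powr_add[symmetric])
  also have "\<dots> \<le> a powr c * d powr (b - c)"
    using False assms by (intro mult_right_mono powr_mono2) auto
  finally show ?thesis .
qed

locale jump =
  fixes \<nu> :: "(real ^ 'd::finite) measure"
  assumes jump_measure: "jump_measure \<nu>"
begin

lemma sets_nu [measurable_cong]: "sets \<nu> = sets borel"
  using jump_measure by (simp add: jump_measure_def)

lemma space_nu [simp]: "space \<nu> = UNIV"
  using sets_eq_imp_space_eq[OF sets_nu] by simp

lemma integrable_rho: "integrable \<nu> rho"
  using jump_measure by (intro integrableI_bounded) (auto simp: jump_measure_def rho_def)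

text \<open>
  The sets where \<open>rho\<close> exceeds \<open>1 / (n + 1)\<close> have finite measure by Markov's inequality and exhaust
  everything but the null set \<open>{0}\<close>.
\<close>

lemma sigma_finite_nu: "sigma_finite_measure \<nu>"
proof
  let ?A = "\<lambda>n::nat. {z. 1 / Suc n \<le> rho z}"
  have fin: "emeasure \<nu> (?A n) \<noteq> \<infinity>" for n
  proof -
    have "emeasure \<nu> {z \<in> space \<nu>. 1 \<le> ennreal (Suc n) * ennreal (rho z)}
        \<le> ennreal (Suc n) * (\<integral>\<^sup>+z. ennreal (rho z) * indicator (space \<nu>) z \<partial>\<nu>)"
      by (intro nn_integral_Markov_inequality) auto
    also have "\<dots> < \<infinity>"
      using jump_measure by (auto simp: ennreal_mult_less_top jump_measure_def rho_def)
    also have "{z \<in> space \<nu>. 1 \<le> ennreal (Suc n) * ennreal (rho z)} = ?A n"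
      by (auto simp: ennreal_mult[symmetric] ennreal_1[symmetric] field_simps simp del: ennreal_1 of_nat_Suc)
    finally show ?thesis by simp
  qed
  have "z \<in> {0} \<union> (\<Union>n. ?A n)" for z
  proof (cases "z = 0")
    case False
    then obtain n where "inverse (real (Suc n)) < rho z" using reals_Archimedean rho_pos by metis
    then show ?thesis by (auto simp: inverse_eq_divide intro!: exI[of _ n] less_imp_le)
  qed simp
  then have cover: "\<Union> (insert {0} (range ?A)) = space \<nu>" by auto
  have meas: "?A n \<in> sets \<nu>" for n by measurable
  show "\<exists>A. countable A \<and> A \<subseteq> sets \<nu> \<and> \<Union> A = space \<nu> \<and> (\<forall>a\<in>A. emeasure \<nu> a \<noteq> \<infinity>)"
  proof (rule exI[of _ "insert {0} (range ?A)"], intro conjI)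
    show "insert {0} (range ?A) \<subseteq> sets \<nu>"
      using meas by (intro insert_subsetI) (simp_all add: sets_nu image_subset_iff)
    show "\<forall>a\<in>insert {0} (range ?A). emeasure \<nu> a \<noteq> \<infinity>"
      using fin jump_measure by (simp add: jump_measure_def)
  qed (use cover in simp_all)
qed

lemma integrable_iexp: "integrable \<nu> (\<lambda>z. 1 - iexp (\<xi> \<bullet> z))"
  by (rule Bochner_Integration.integrable_bound[OF integrable_mult_right[OF integrable_rho, of "2 + norm \<xi>"]])
     (use iexp_bound in auto)

lemma norm_psi_le: "cmod (psi \<nu> \<xi>) \<le> (2 + norm \<xi>) * (\<integral>z. rho z \<partial>\<nu>)"
proof -
  have "cmod (psi \<nu> \<xi>) \<le> (\<integral>z. (2 + norm \<xi>) * rho z \<partial>\<nu>)"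
    unfolding psi_def
    by (intro Bochner_Integration.integral_norm_bound_integral integrable_iexp integrable_mult_right integrable_rho iexp_bound)
  then show ?thesis by simp
qed

lemma Re_psi: "Re (psi \<nu> \<xi>) = (\<integral>z. 1 - cos (\<xi> \<bullet> z) \<partial>\<nu>)"
  unfolding psi_def integral_Re[OF integrable_iexp, symmetric] by (simp add: Re_exp)

lemma integrable_one_minus_cos: "integrable \<nu> (\<lambda>z. 1 - cos (\<xi> \<bullet> z))"
  using integrable_Re[OF integrable_iexp[of \<xi>]] by (simp add: Re_exp)

lemma Re_psi_nonneg: "0 \<le> Re (psi \<nu> \<xi>)"
  unfolding Re_psi by (intro integral_nonneg_AE) auto

lemma psi_measurable [measurable]: "psi \<nu> \<in> borel_measurable borel"
proof -
  interpret sigma_finite_measure \<nu> by (rule sigma_finite_nu)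
  have "(\<lambda>\<xi>. \<integral> z. 1 - iexp (\<xi> \<bullet> z) \<partial>\<nu>) \<in> borel_measurable borel"
    by measurable
  then show ?thesis by (simp add: psi_def[abs_def])
qed

lemma Re_psi_le_psi_star:
  assumes "norm \<xi> \<le> r"
  shows "Re (psi \<nu> \<xi>) \<le> psi_star \<nu> r"
  unfolding psi_star_def
proof (rule cSUP_upper)
  have "0 \<le> (\<integral>z. rho z \<partial>\<nu>)" by (intro integral_nonneg_AE) auto
  then have "Re (psi \<nu> \<xi>) \<le> (2 + r) * (\<integral>z. rho z \<partial>\<nu>)" if "norm \<xi> \<le> r" for \<xi>
    using norm_psi_le[of \<xi>] complex_Re_le_cmod[of "psi \<nu> \<xi>"] that
    by (smt (verit) mult_right_mono)
  then show "bdd_above ((\<lambda>\<xi>. Re (psi \<nu> \<xi>)) ` {\<xi>. norm \<xi> \<le> r})"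
    by (intro bdd_aboveI2) auto
qed (use assms in auto)

text \<open>
  Testing \<open>psi\<close> at \<open>R\<close> times a coordinate vector \<open>b\<close> bounds the second moment of the \<open>b\<close>-coordinate on
  \<open>|z| \<le> 1/R\<close>, where the phase stays in \<open>[-1, 1]\<close>. Summation over the coordinates gives \<open>|z|\<^sup>2\<close>.
\<close>

lemma truncated_second_moment:
  assumes "1 \<le> R"
  shows "integrable \<nu> (\<lambda>z. (norm z)\<^sup>2 * indicator {z. norm z \<le> 1 / R} z)" (is ?I)
    and "(\<integral>z. (norm z)\<^sup>2 * indicator {z. norm z \<le> 1 / R} z \<partial>\<nu>) \<le> 4 * real CARD('d) / R\<^sup>2 * psi_star \<nu> R" (is ?B)
proof -
  have *: "norm ((norm z)\<^sup>2 * indicator {z. norm z \<le> 1 / R} z) \<le> norm (rho z)" for z :: "real ^ 'd"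
  proof (cases "norm z \<le> 1 / R")
    case True
    moreover have "1 / R \<le> 1" using assms by simp
    ultimately have "norm z \<le> 1" by linarith
    then show ?thesis using True mult_left_le[of "norm z" "norm z"] by (simp add: rho_def power2_eq_square)
  qed simp
  show I: ?I
    by (rule Bochner_Integration.integrable_bound[OF integrable_rho]) (use * in auto)
  have coord: "(\<integral>z. (z \<bullet> b)\<^sup>2 * indicator {z. norm z \<le> 1 / R} z \<partial>\<nu>) \<le> 4 / R\<^sup>2 * psi_star \<nu> R"
    and icoord: "integrable \<nu> (\<lambda>z. (z \<bullet> b)\<^sup>2 * indicator {z. norm z \<le> 1 / R} z)"
    if b: "b \<in> Basis" for b :: "real ^ 'd"
  proof -
    show int: "integrable \<nu> (\<lambda>z. (z \<bullet> b)\<^sup>2 * indicator {z. norm z \<le> 1 / R} z)"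
    proof (rule Bochner_Integration.integrable_bound[OF I])
      show "AE z in \<nu>. norm ((z \<bullet> b)\<^sup>2 * indicator {z. norm z \<le> 1 / R} z)
          \<le> norm ((norm z)\<^sup>2 * indicator {z. norm z \<le> 1 / R} z)"
        using Basis_le_norm[OF b] by (auto simp: indicator_def abs_le_square_iff[symmetric] intro!: AE_I2)
    qed measurable
    have "(z \<bullet> b)\<^sup>2 * indicator {z. norm z \<le> 1 / R} z \<le> 4 / R\<^sup>2 * (1 - cos ((R *\<^sub>R b) \<bullet> z))" for z
    proof (cases "norm z \<le> 1 / R")
      case True
      have "\<bar>R * (z \<bullet> b)\<bar> \<le> R * norm z"
        using Basis_le_norm[OF b, of z] assms by (simp add: abs_mult)
      also have "\<dots> \<le> 1" using True assms by (simp add: field_simps)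
      finally have "(R * (z \<bullet> b))\<^sup>2 / 4 \<le> 1 - cos (R * (z \<bullet> b))" by (rule one_minus_cos_ge)
      then show ?thesis using True assms by (simp add: field_simps power_mult_distrib inner_commute)
    qed simp
    then have "(\<integral>z. (z \<bullet> b)\<^sup>2 * indicator {z. norm z \<le> 1 / R} z \<partial>\<nu>) \<le> (\<integral>z. 4 / R\<^sup>2 * (1 - cos ((R *\<^sub>R b) \<bullet> z)) \<partial>\<nu>)"
      by (intro integral_mono int integrable_mult_right integrable_one_minus_cos)
    also have "\<dots> = 4 / R\<^sup>2 * Re (psi \<nu> (R *\<^sub>R b))"
      unfolding Re_psi by (rule integral_mult_right_zero)
    also have "\<dots> \<le> 4 / R\<^sup>2 * psi_star \<nu> R"
      using b assms by (intro mult_left_mono Re_psi_le_psi_star) auto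
    finally show "(\<integral>z. (z \<bullet> b)\<^sup>2 * indicator {z. norm z \<le> 1 / R} z \<partial>\<nu>) \<le> 4 / R\<^sup>2 * psi_star \<nu> R" .
  qed
  have "(norm z)\<^sup>2 = (\<Sum>b\<in>Basis. (z \<bullet> b)\<^sup>2)" for z :: "real ^ 'd"
    unfolding power2_norm_eq_inner by (subst euclidean_inner) (simp add: power2_eq_square)
  then have "(norm z)\<^sup>2 * c = (\<Sum>b\<in>Basis. (z \<bullet> b)\<^sup>2 * c)" for z :: "real ^ 'd" and c
    by (simp add: sum_distrib_right)
  then have "(\<integral>z. (norm z)\<^sup>2 * indicator {z. norm z \<le> 1 / R} z \<partial>\<nu>)
      = (\<Sum>b\<in>Basis. \<integral>z. (z \<bullet> b)\<^sup>2 * indicator {z. norm z \<le> 1 / R} z \<partial>\<nu>)"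
    using icoord by (simp only:) (intro Bochner_Integration.integral_sum)
  also have "\<dots> \<le> (\<Sum>b\<in>(Basis :: (real ^ 'd) set). 4 / R\<^sup>2 * psi_star \<nu> R)"
    by (intro sum_mono coord)
  finally show ?B by (simp add: mult_ac)
qed

text \<open>
  On the dyadic shell \<open>2\<^bsup>-(k+2)\<^esup> < |z| \<le> 2\<^bsup>-(k+1)\<^esup>\<close> the function \<open>|z|\<^sup>\<gamma>\<close> is comparable to
  \<open>2\<^bsup>(k+1)(2-\<gamma>)\<^esup> |z|\<^sup>2\<close>. By the truncated second moment and the growth bound, the integrals of the latter
  decay like \<open>2\<^bsup>(k+1)(\<alpha>-\<gamma>)\<^esup>\<close>, which is summable as \<open>\<gamma> > \<alpha>\<close>.
\<close>

lemma integrable_rho_powr: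
  assumes growth: "\<And>R. 2 \<le> R \<Longrightarrow> psi_star \<nu> R \<le> D * R powr \<alpha>"
    and "\<alpha> < \<gamma>" "0 < \<gamma>" "\<gamma> \<le> 2"
  shows "integrable \<nu> (\<lambda>z. rho z powr \<gamma>)"
proof -
  define T :: "nat \<Rightarrow> real ^ 'd \<Rightarrow> real" where
    "T k z = (2 ^ Suc k) powr (2 - \<gamma>) * ((norm z)\<^sup>2 * indicator {z. norm z \<le> 1 / 2 ^ Suc k} z)" for k z
  define E where "E = 4 * real CARD('d) * \<bar>D\<bar>"
  define q :: real where "q = 2 powr (\<alpha> - \<gamma>)"
  have T_nonneg: "0 \<le> T k z" for k z by (simp add: T_def)
  have [measurable]: "T k \<in> borel_measurable borel" for k
    unfolding T_def by measurable
  have T_le: "(\<integral>\<^sup>+z. ennreal (T k z) \<partial>\<nu>) \<le> ennreal (E * q ^ Suc k)" for k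
  proof -
    define R :: real where "R = 2 ^ Suc k"
    have "2 \<le> R" using one_le_power[of "2::real" k] by (simp add: R_def)
    then have R: "2 \<le> R" "1 \<le> R" "0 < R" by auto
    have int: "integrable \<nu> (T k)"
      unfolding T_def by (intro integrable_mult_right truncated_second_moment) (use R(2) in \<open>simp only: R_def\<close>)
    have "(\<integral>z. T k z \<partial>\<nu>) = R powr (2 - \<gamma>) * (\<integral>z. (norm z)\<^sup>2 * indicator {z. norm z \<le> 1 / R} z \<partial>\<nu>)"
      unfolding T_def R_def by (rule integral_mult_right_zero)
    also have "\<dots> \<le> R powr (2 - \<gamma>) * (4 * real CARD('d) / R\<^sup>2 * psi_star \<nu> R)"
      by (intro mult_left_mono truncated_second_moment R) auto
    also have "\<dots> \<le> R powr (2 - \<gamma>) * (4 * real CARD('d) / R\<^sup>2 * (\<bar>D\<bar> * R powr \<alpha>))"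
      using order_trans[OF growth[OF R(1)] mult_right_mono[OF abs_ge_self[of D], of "R powr \<alpha>"]]
      by (intro mult_left_mono) auto
    also have "\<dots> = E * (R powr (2 - \<gamma>) * R powr \<alpha> / R powr 2)"
      using R by (simp add: E_def)
    also have "R powr (2 - \<gamma>) * R powr \<alpha> / R powr 2 = R powr (\<alpha> - \<gamma>)"
      by (simp add: powr_add[symmetric] powr_diff[symmetric])
    also have "\<dots> = q ^ Suc k"
      by (simp add: R_def q_def powr_realpow[symmetric] powr_powr mult.commute del: power_Suc)
    finally show ?thesis
      using int T_nonneg by (simp add: nn_integral_eq_integral ennreal_leI)
  qed
  have q: "0 < q" "q < 1" using assms by (auto simp: q_def powr_less_one)
  then have "summable (\<lambda>k. E * q ^ Suc k)"
    by (intro summable_mult) (simp add: summable_mult summable_geometric)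
  then have fin: "(\<Sum>k. ennreal (E * q ^ Suc k)) \<noteq> \<infinity>"
    using q unfolding infinity_ennreal_def by (intro ennreal_suminf_neq_top) (auto simp: E_def)
  have bound: "ennreal (rho z powr \<gamma>) \<le> 2 * ennreal (rho z) + 4 * (\<Sum>k. ennreal (T k z))" for z
  proof (cases "norm z \<le> 1 / 2")
    case False
    then have "1 \<le> 2 * rho z" by (auto simp: rho_def)
    then have "rho z powr \<gamma> \<le> 2 * rho z" using rho_powr_le_1[of \<gamma> z] assms by auto
    then have "ennreal (rho z powr \<gamma>) \<le> 2 * ennreal (rho z)"
      using ennreal_leI[of "rho z powr \<gamma>" "2 * rho z"] by (simp add: ennreal_mult)
    then show ?thesis by (rule add_increasing2[rotated]) simp
  next
    case True
    show ?thesis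
    proof (cases "z = 0")
      case False
      define n where "n = (LEAST n. (1 / 2) ^ n < norm z)"
      have ex: "\<exists>n. (1 / 2) ^ n < norm z" using real_arch_pow_inv[of "norm z" "1 / 2"] False by auto
      have n: "(1 / 2) ^ n < norm z" unfolding n_def by (rule LeastI_ex[OF ex])
      have min: "norm z \<le> (1 / 2) ^ m" if "m < n" for m
        using not_less_Least[OF that[unfolded n_def]] by simp
      have "n \<noteq> 0" "n \<noteq> 1" using n True by (auto intro: ccontr)
      then obtain k where k: "n = Suc (Suc k)" by (metis One_nat_def not0_implies_Suc)
      have z: "norm z \<le> 1 / 2 ^ Suc k" "1 / 2 ^ Suc (Suc k) < norm z"
        using min[of "Suc k"] n by (auto simp: k power_one_over)
      have "rho z powr \<gamma> = (norm z)\<^sup>2 * (1 / norm z) powr (2 - \<gamma>)"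
      proof -
        have "(norm z)\<^sup>2 * (1 / norm z) powr (2 - \<gamma>) = norm z powr 2 / norm z powr (2 - \<gamma>)"
          using False by (simp add: powr_divide)
        also have "\<dots> = norm z powr \<gamma>" by (simp only: powr_diff[symmetric]) simp
        finally show ?thesis using True by (simp add: rho_def)
      qed
      also have "\<dots> \<le> (norm z)\<^sup>2 * (2 * 2 ^ Suc k) powr (2 - \<gamma>)"
        using z(2) False assms by (intro mult_left_mono powr_mono2) (auto simp: field_simps)
      also have "\<dots> = 2 powr (2 - \<gamma>) * T k z"
        unfolding powr_mult using z(1) by (simp add: T_def)
      also have "\<dots> \<le> 2 powr 2 * T k z"
        using assms by (intro mult_right_mono T_nonneg powr_mono) auto
      finally have "ennreal (rho z powr \<gamma>) \<le> ennreal (4 * T k z)"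
        by (intro ennreal_leI) simp
      also have "\<dots> = 4 * ennreal (T k z)" by (simp add: ennreal_mult T_nonneg)
      also have "\<dots> \<le> 4 * (\<Sum>k. ennreal (T k z))"
        using sum_le_suminf[of "\<lambda>k. ennreal (T k z)" "{k}"] by (intro mult_left_mono) auto
      finally show ?thesis by (rule add_increasing[rotated]) simp_all
    qed simp
  qed
  have "(\<integral>\<^sup>+z. ennreal (norm (rho z powr \<gamma>)) \<partial>\<nu>) \<le> (\<integral>\<^sup>+z. 2 * ennreal (rho z) + 4 * (\<Sum>k. ennreal (T k z)) \<partial>\<nu>)"
    by (intro nn_integral_mono) (use bound in simp)
  also have "\<dots> = 2 * (\<integral>\<^sup>+z. ennreal (rho z) \<partial>\<nu>) + 4 * (\<Sum>k. \<integral>\<^sup>+z. ennreal (T k z) \<partial>\<nu>)"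
    by (simp add: nn_integral_add nn_integral_cmult nn_integral_suminf)
  also have "\<dots> \<le> 2 * (\<integral>\<^sup>+z. ennreal (rho z) \<partial>\<nu>) + 4 * (\<Sum>k. ennreal (E * q ^ Suc k))"
    by (intro add_left_mono mult_left_mono suminf_le T_le) auto
  also have "\<dots> < \<infinity>"
    using fin jump_measure
    by (auto simp: ennreal_mult_eq_top_iff less_top[symmetric] jump_measure_def rho_def)
  finally show ?thesis by (intro integrableI_bounded) auto
qed

lemma integrable_increment:
  assumes "hoelder K b g" "0 < b" "c \<le> b" "integrable \<nu> (\<lambda>z. rho z powr c)"
  shows "integrable \<nu> (\<lambda>z. g (x + z) - g x)"
proof (rule Bochner_Integration.integrable_bound[OF integrable_mult_right[OF assms(4), of K]])
  note [measurable] = BUC_measurable[OF hoelder_BUC[OF assms(1,2)]]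
  show "(\<lambda>z. g (x + z) - g x) \<in> borel_measurable \<nu>" by measurable
  have "\<bar>g (x + z) - g x\<bar> \<le> K * rho z powr c" for z
    using assms(1) mult_left_mono[OF rho_powr_antimono[OF assms(3), of z], of K]
    unfolding hoelder_def by (smt (verit) add_diff_cancel_left')
  then show "AE z in \<nu>. norm (g (x + z) - g x) \<le> norm (K * rho z powr c)"
    using assms(1) by (auto simp: hoelder_def abs_mult)
qed

text \<open>
  The second difference is estimated in two ways, pairing its terms by the shift \<open>z\<close> or by the points
  \<open>x, y\<close>, and the two bounds are interpolated so that the \<open>z\<close>-dependence becomes integrable.
\<close>

lemma levy_op_hoelder:
  assumes "hoelder K b g" "0 < b" "0 \<le> c" "c \<le> b" "integrable \<nu> (\<lambda>z. rho z powr c)"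
  shows "hoelder (2 * K * (\<integral>z. rho z powr c \<partial>\<nu>)) (b - c) (levy_op \<nu> g)"
  unfolding hoelder_def
proof (intro conjI allI)
  have K: "0 \<le> K" and bd: "\<bar>g x - g y\<bar> \<le> K * rho (x - y) powr b" for x y
    using assms(1) by (auto simp: hoelder_def)
  show "0 \<le> 2 * K * (\<integral>z. rho z powr c \<partial>\<nu>)"
    using K by (intro mult_nonneg_nonneg integral_nonneg_AE) auto
  fix x y
  note int = integrable_increment[OF assms(1,2,4,5)]
  have pw: "\<bar>(g (x + z) - g x) - (g (y + z) - g y)\<bar> \<le> 2 * K * rho (x - y) powr (b - c) * rho z powr c" for z
  proof (cases "K = 0")
    case True
    then show ?thesis using bd[of "x + z" x] bd[of "y + z" y] by auto
  next
    case False
    then have pos: "0 < 2 * K" using K by simp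
    have "\<bar>g (x + z) - g x\<bar> \<le> K * rho z powr b" "\<bar>g (y + z) - g y\<bar> \<le> K * rho z powr b"
      "\<bar>g (x + z) - g (y + z)\<bar> \<le> K * rho (x - y) powr b" "\<bar>g x - g y\<bar> \<le> K * rho (x - y) powr b"
      using bd[of "x + z" x] bd[of "y + z" y] bd[of "x + z" "y + z"] bd[of x y] by simp_all
    then have "\<bar>(g (x + z) - g x) - (g (y + z) - g y)\<bar> \<le> 2 * K * rho z powr b"
      "\<bar>(g (x + z) - g x) - (g (y + z) - g y)\<bar> \<le> 2 * K * rho (x - y) powr b" by linarith+
    then have "\<bar>(g (x + z) - g x) - (g (y + z) - g y)\<bar> / (2 * K) \<le> rho z powr c * rho (x - y) powr (b - c)"
      using pos assms by (intro powr_interpolation) (auto simp: divide_le_eq mult.commute)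
    then show ?thesis using pos by (simp add: divide_le_eq mult_ac)
  qed
  have "norm (\<integral>z. (g (x + z) - g x) - (g (y + z) - g y) \<partial>\<nu>)
      \<le> (\<integral>z. 2 * K * rho (x - y) powr (b - c) * rho z powr c \<partial>\<nu>)"
    using pw by (intro Bochner_Integration.integral_norm_bound_integral
        Bochner_Integration.integrable_diff int integrable_mult_right assms(5)) auto
  then show "\<bar>levy_op \<nu> g x - levy_op \<nu> g y\<bar> \<le> 2 * K * (\<integral>z. rho z powr c \<partial>\<nu>) * rho (x - y) powr (b - c)"
    using int by (simp add: levy_op_def mult_ac)
qed

text \<open>
  Dominated convergence with majorant \<open>K \<rho>\<^sup>c\<close>. The moving base points \<open>X n\<close> serve to show decay at infinity;
  the moving functions \<open>G n\<close> serve to pass to the limit in the mollification.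
\<close>

lemma levy_op_tendsto:
  assumes "integrable \<nu> (\<lambda>z. rho z powr c)" "c \<le> b" "0 < b"
    and "\<And>n. hoelder K b (G n)"
    and "g \<in> borel_measurable borel" "\<And>z. (\<lambda>n. G n (X n + z) - G n (X n)) \<longlonglongrightarrow> g z"
  shows "(\<lambda>n. levy_op \<nu> (G n) (X n)) \<longlonglongrightarrow> (\<integral>z. g z \<partial>\<nu>)"
  unfolding levy_op_def
proof (rule integral_dominated_convergence)
  show "integrable \<nu> (\<lambda>z. K * rho z powr c)" by (intro integrable_mult_right assms)
  show "(\<lambda>z. G n (X n + z) - G n (X n)) \<in> borel_measurable \<nu>" for n
    using integrable_increment[OF assms(4,3,2,1)] by (rule borel_measurable_integrable)
  have "\<bar>G n (x + z) - G n x\<bar> \<le> K * rho z powr c" for n x z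
    using assms(4)[of n] mult_left_mono[OF rho_powr_antimono[OF assms(2), of z], of K]
    unfolding hoelder_def by (smt (verit) add_diff_cancel_left')
  then show "AE z in \<nu>. norm (G n (X n + z) - G n (X n)) \<le> K * rho z powr c" for n
    by simp
qed (use assms in \<open>auto simp: sets_nu cong: measurable_cong_sets\<close>)

text \<open>
  A failure of decay would be witnessed along a sequence escaping to infinity, on which the increments
  of \<open>g\<close> tend to \<open>0\<close> pointwise and are dominated.
\<close>

lemma levy_op_C0:
  assumes "g \<in> C0" "hoelder K b g" "0 < c" "c < b" "integrable \<nu> (\<lambda>z. rho z powr c)"
  shows "levy_op \<nu> g \<in> C0"
proof -
  have "levy_op \<nu> g \<in> BUC"
    using assms by (intro hoelder_BUC[OF levy_op_hoelder[OF assms(2)]]) auto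
  then have "continuous_on UNIV (levy_op \<nu> g)"
    by (auto simp: BUC_def intro: uniformly_continuous_imp_continuous)
  moreover have "(levy_op \<nu> g \<longlongrightarrow> 0) at_infinity"
  proof (rule ccontr)
    assume "\<not> ?thesis"
    then obtain e where e: "e > 0" "\<And>b. \<exists>x. norm x \<ge> b \<and> \<bar>levy_op \<nu> g x\<bar> \<ge> e"
      unfolding Lim_at_infinity by (auto simp: not_less)
    from e(2) have "\<exists>X. \<forall>n::nat. norm (X n) \<ge> real n \<and> \<bar>levy_op \<nu> g (X n)\<bar> \<ge> e"
      by (intro choice) blast
    then obtain X where X: "\<And>n::nat. norm (X n) \<ge> real n" "\<And>n. \<bar>levy_op \<nu> g (X n)\<bar> \<ge> e"
      by blast
    have lim: "(\<lambda>n. g (X n + z)) \<longlonglongrightarrow> 0" for z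
    proof -
      have "filterlim (\<lambda>n. X n + z) at_infinity sequentially"
        unfolding filterlim_at_infinity[OF order_refl]
      proof (intro allI impI)
        fix r :: real
        show "eventually (\<lambda>n. r \<le> norm (X n + z)) sequentially"
          using eventually_ge_at_top[of "nat \<lceil>r + norm z\<rceil>"]
        proof eventually_elim
          case (elim n)
          then have "r + norm z \<le> real n" by linarith
          then show ?case using X(1)[of n] norm_triangle_ineq4[of "X n + z" z] by simp
        qed
      qed
      moreover have "(g \<longlongrightarrow> 0) at_infinity" using assms(1) by (simp add: C0_def)
      ultimately show ?thesis by (rule filterlim_compose[rotated])
    qed
    have "(\<lambda>n. levy_op \<nu> g (X n)) \<longlonglongrightarrow> (\<integral>z. 0 \<partial>\<nu>)"
      using assms tendsto_diff[OF lim lim[of 0]] by (intro levy_op_tendsto[of c b K]) auto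
    then have "eventually (\<lambda>n. \<bar>levy_op \<nu> g (X n)\<bar> < e) sequentially"
      using e(1) by (auto simp: tendsto_iff dist_real_def)
    then show False using X(2) by (auto simp: eventually_sequentially not_less[symmetric])
  qed
  ultimately show ?thesis by (simp add: C0_def)
qed

end

section \<open>The generator on superpositions of characters\<close>

text \<open>
  The finite first moment of \<open>M\<close> makes \<open>psi\<close>, which grows at most linearly, integrable.
\<close>

definition fourier_rep :: "(real ^ 'd::finite \<Rightarrow> real) \<Rightarrow> bool" where
  "fourier_rep g \<longleftrightarrow> (\<exists>M c B. finite_measure M \<and> sets M = sets borel \<and> integrable M norm \<and>
     c \<in> borel_measurable borel \<and> (\<forall>\<xi>. cmod (c \<xi>) \<le> B) \<and>
     (\<forall>x. complex_of_real (g x) = (\<integral>\<xi>. c \<xi> * iexp (x \<bullet> \<xi>) \<partial>M)))"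

lemma norm_exp_minus_1_le:
  assumes "0 \<le> Re w"
  shows "cmod (exp (- w) - 1) \<le> cmod w"
proof -
  have "cmod (exp (- w) - exp 0) \<le> 1 * cmod (- w - 0)"
    by (rule field_differentiable_bound[OF convex_halfspace_Re_le[of 0], where f' = exp])
       (use assms in \<open>auto intro!: DERIV_subset[OF DERIV_exp]\<close>)
  then show ?thesis by simp
qed

lemma exp_difference_quotient:
  fixes S :: "nat \<Rightarrow> real" and w :: complex
  assumes "\<And>n. 0 < S n" "S \<longlonglongrightarrow> 0"
  shows "(\<lambda>n. (exp (- of_real (S n) * w) - 1) / of_real (S n)) \<longlonglongrightarrow> - w"
proof (cases "w = 0")
  case False
  have "((\<lambda>h::complex. (exp (0 + h) - exp 0) / h) \<longlongrightarrow> exp 0) (at 0)"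
    using DERIV_exp[of "0::complex"] by (simp add: DERIV_def)
  moreover have "filterlim (\<lambda>n. - of_real (S n) * w) (at 0) sequentially"
    unfolding filterlim_at
  proof
    show "eventually (\<lambda>n. - of_real (S n) * w \<in> UNIV \<and> - of_real (S n) * w \<noteq> 0) sequentially"
      using False assms(1) by (auto simp: less_imp_neq[symmetric] order.strict_implies_not_eq)
    have "(\<lambda>n. - of_real (S n) * w) \<longlonglongrightarrow> - of_real 0 * w"
      by (intro tendsto_intros assms)
    then show "(\<lambda>n. - of_real (S n) * w) \<longlonglongrightarrow> 0" by simp
  qed
  ultimately have "(\<lambda>n. (exp (0 + - of_real (S n) * w) - exp 0) / (- of_real (S n) * w)) \<longlonglongrightarrow> exp 0"
    by (rule filterlim_compose)
  then have "(\<lambda>n. (exp (0 + - of_real (S n) * w) - exp 0) / (- of_real (S n) * w) * (- w)) \<longlonglongrightarrow> exp 0 * (- w)"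
    by (rule tendsto_mult_right)
  then show ?thesis using False by simp
qed simp

locale levy_semigroup = conv_semigroup p + jump \<nu>
  for p :: "real \<Rightarrow> (real ^ 'd::finite) measure" and \<nu> +
  assumes char_p: "t \<ge> 0 \<Longrightarrow> (\<integral> x. iexp (\<xi> \<bullet> x) \<partial>p t) = exp (- complex_of_real t * psi \<nu> \<xi>)"
begin

text \<open>
  On the character \<open>x \<mapsto> e\<^bsup>i x \<bullet> \<xi>\<^esup>\<close> the operators \<open>P\<^sub>t\<close> and \<open>A\<close> act as multiplication by \<open>e\<^bsup>-t\<psi>(\<xi>)\<^esup>\<close> and
  \<open>-\<psi>(\<xi>)\<close>. Fubini transfers this to superpositions, and the error of the difference quotient is
  bounded, uniformly in \<open>x\<close>, by the \<open>M\<close>-integral of \<open>|(e\<^bsup>-h\<psi>\<^esup> - 1)/h + \<psi>|\<close>, which vanishes by dominated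
  convergence because the integrand is at most \<open>2|\<psi>|\<close>.
\<close>

lemma fourier_gen:
  assumes "fourier_rep g" "g \<in> BUC" "levy_op \<nu> g \<in> BUC"
  shows "gen g (levy_op \<nu> g)"
proof -
  from assms(1) obtain M c B where M: "finite_measure M" "sets M = sets borel" "integrable M norm"
    and c: "c \<in> borel_measurable borel" "\<And>\<xi>. cmod (c \<xi>) \<le> B"
    and g: "\<And>x. complex_of_real (g x) = (\<integral>\<xi>. c \<xi> * iexp (x \<bullet> \<xi>) \<partial>M)"
    unfolding fourier_rep_def by blast
  note [measurable] = c(1) BUC_measurable[OF assms(2)]
  note [measurable_cong] = M(2)
  interpret M: finite_measure M by (rule M)
  interpret nu: sigma_finite_measure \<nu> by (rule sigma_finite_nu)
  interpret nuM: pair_sigma_finite \<nu> M ..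
  have B: "0 \<le> B" using order_trans[OF norm_ge_zero c(2)] .
  let ?e = "\<lambda>x \<xi>. c \<xi> * iexp (x \<bullet> \<xi>)"
  have norm_e: "cmod (?e x \<xi>) \<le> B" for x \<xi> using c(2) by (simp add: norm_mult)
  have e_add: "?e (x + y) \<xi> = ?e x \<xi> * iexp (\<xi> \<bullet> y)" for x y \<xi>
    by (simp add: inner_add_left distrib_left exp_add mult.assoc inner_commute[of \<xi> y])
  have int_e: "integrable M (?e x)" for x
    using norm_e by (intro M.integrable_const_bound[of _ B]) auto
  have int_lin: "integrable M (\<lambda>\<xi>. 2 + norm \<xi>)" using M by simp
  have int_psi: "integrable M (\<lambda>\<xi>. (\<integral>z. rho z \<partial>\<nu>) * (2 + norm \<xi>))"
    by (intro integrable_mult_right int_lin)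
  have int_epsi: "integrable M (\<lambda>\<xi>. ?e x \<xi> * psi \<nu> \<xi>)" for x
  proof (rule Bochner_Integration.integrable_bound[OF integrable_mult_right[OF int_psi, of B]])
    have "cmod (?e x \<xi> * psi \<nu> \<xi>) \<le> B * ((\<integral>z. rho z \<partial>\<nu>) * (2 + norm \<xi>))" for \<xi>
      unfolding norm_mult[of "?e x \<xi>"]
      by (intro mult_mono norm_e B norm_ge_zero) (use norm_psi_le[of \<xi>] in \<open>simp add: mult.commute\<close>)
    then show "AE \<xi> in M. norm (?e x \<xi> * psi \<nu> \<xi>) \<le> norm (B * ((\<integral>z. rho z \<partial>\<nu>) * (2 + norm \<xi>)))"
      by (intro AE_I2) (metis abs_ge_self order_trans real_norm_def)
  qed measurable
  have Pt: "complex_of_real (semigroup_op p t g x) = (\<integral>\<xi>. ?e x \<xi> * exp (- of_real t * psi \<nu> \<xi>) \<partial>M)"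
    and int_Pt: "integrable M (\<lambda>\<xi>. ?e x \<xi> * exp (- of_real t * psi \<nu> \<xi>))"
    if t: "t \<ge> 0" for t x
  proof -
    note [measurable_cong] = sets_p[OF t]
    interpret pt: prob_space "p t" using t by (rule prob_space_p)
    interpret pM: pair_sigma_finite "p t" M ..
    interpret pM': finite_measure "p t \<Otimes>\<^sub>M M"
      by (intro finite_measure_pair_measure pt.finite_measure_axioms M)
    have "integrable (p t \<Otimes>\<^sub>M M) (\<lambda>(y, \<xi>). ?e (x + y) \<xi>)"
      using norm_e by (intro pM'.integrable_const_bound[of _ B]) auto
    note Fub = pM.Fubini_integral[OF this]
    have "complex_of_real (semigroup_op p t g x) = (\<integral>y. complex_of_real (g (x + y)) \<partial>p t)"
      by (simp add: semigroup_op_def)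
    also have "\<dots> = (\<integral>y. \<integral>\<xi>. ?e (x + y) \<xi> \<partial>M \<partial>p t)"
      by (simp only: g)
    also have "\<dots> = (\<integral>\<xi>. \<integral>y. ?e (x + y) \<xi> \<partial>p t \<partial>M)"
      using Fub by simp
    also have "(\<lambda>\<xi>. \<integral>y. ?e (x + y) \<xi> \<partial>p t) = (\<lambda>\<xi>. \<integral>y. ?e x \<xi> * iexp (\<xi> \<bullet> y) \<partial>p t)"
      by (simp only: e_add)
    also have "\<dots> = (\<lambda>\<xi>. ?e x \<xi> * exp (- of_real t * psi \<nu> \<xi>))"
      using t by (simp only: integral_mult_right_zero char_p)
    finally show "complex_of_real (semigroup_op p t g x) = (\<integral>\<xi>. ?e x \<xi> * exp (- of_real t * psi \<nu> \<xi>) \<partial>M)" .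
    have "cmod (exp (- of_real t * psi \<nu> \<xi>)) \<le> 1" for \<xi>
      using t Re_psi_nonneg[of \<xi>] by simp
    then have "cmod (?e x \<xi> * exp (- of_real t * psi \<nu> \<xi>)) \<le> B * 1" for \<xi>
      unfolding norm_mult[of "?e x \<xi>"] by (intro mult_mono norm_e B norm_ge_zero)
    then show "integrable M (\<lambda>\<xi>. ?e x \<xi> * exp (- of_real t * psi \<nu> \<xi>))"
      by (intro M.integrable_const_bound[of _ B]) auto
  qed
  have A: "complex_of_real (levy_op \<nu> g x) = (\<integral>\<xi>. - (?e x \<xi> * psi \<nu> \<xi>) \<partial>M)" for x
  proof -
    let ?k = "\<lambda>z \<xi>. ?e x \<xi> * (iexp (\<xi> \<bullet> z) - 1)"
    have "integrable (\<nu> \<Otimes>\<^sub>M M) (\<lambda>(z, \<xi>). rho z * (2 + norm \<xi>))"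
      using integrable_rho int_lin
      by (intro nuM.Fubini_integrable) (auto simp: abs_mult)
    then have "integrable (\<nu> \<Otimes>\<^sub>M M) (\<lambda>w. B * (case w of (z, \<xi>) \<Rightarrow> rho z * (2 + norm \<xi>)))"
      by (rule integrable_mult_right)
    then have "integrable (\<nu> \<Otimes>\<^sub>M M) (\<lambda>(z, \<xi>). ?k z \<xi>)"
    proof (rule Bochner_Integration.integrable_bound)
      have *: "cmod (?k z \<xi>) \<le> B * (rho z * (2 + norm \<xi>))" for z \<xi>
        unfolding norm_mult[of "?e x \<xi>"] mult.commute[of "rho z"]
        using iexp_bound[of \<xi> z] unfolding norm_minus_commute[of 1] by (intro mult_mono norm_e B norm_ge_zero)
      show "AE w in \<nu> \<Otimes>\<^sub>M M. norm (case w of (z, \<xi>) \<Rightarrow> ?k z \<xi>)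
          \<le> norm (B * (case w of (z, \<xi>) \<Rightarrow> rho z * (2 + norm \<xi>)))"
        unfolding split_beta real_norm_def by (intro AE_I2 order_trans[OF * abs_ge_self])
    qed measurable
    note Fub = nuM.Fubini_integral[OF this]
    have incr: "complex_of_real (g (x + z) - g x) = (\<integral>\<xi>. ?k z \<xi> \<partial>M)" for z
    proof -
      have "complex_of_real (g (x + z) - g x) = (\<integral>\<xi>. ?e (x + z) \<xi> - ?e x \<xi> \<partial>M)"
        unfolding of_real_diff g by (intro Bochner_Integration.integral_diff[symmetric] int_e)
      also have "(\<lambda>\<xi>. ?e (x + z) \<xi> - ?e x \<xi>) = ?k z"
        by (simp add: e_add right_diff_distrib)
      finally show ?thesis .
    qed
    have "complex_of_real (levy_op \<nu> g x) = (\<integral>z. complex_of_real (g (x + z) - g x) \<partial>\<nu>)"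
      unfolding levy_op_def by (rule integral_complex_of_real[symmetric])
    also have "\<dots> = (\<integral>z. \<integral>\<xi>. ?k z \<xi> \<partial>M \<partial>\<nu>)"
      by (simp only: incr)
    also have "\<dots> = (\<integral>\<xi>. \<integral>z. ?k z \<xi> \<partial>\<nu> \<partial>M)"
      using Fub by simp
    also have "(\<lambda>\<xi>. \<integral>z. ?k z \<xi> \<partial>\<nu>) = (\<lambda>\<xi>. - (?e x \<xi> * psi \<nu> \<xi>))"
    proof
      fix \<xi>
      have "(\<integral>z. ?k z \<xi> \<partial>\<nu>) = ?e x \<xi> * (\<integral>z. iexp (\<xi> \<bullet> z) - 1 \<partial>\<nu>)"
        by (rule integral_mult_right_zero)
      also have "(\<integral>z. iexp (\<xi> \<bullet> z) - 1 \<partial>\<nu>) = (\<integral>z. - (1 - iexp (\<xi> \<bullet> z)) \<partial>\<nu>)"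
        by simp
      also have "\<dots> = - psi \<nu> \<xi>"
        unfolding psi_def by (rule integral_minus)
      finally show "(\<integral>z. ?k z \<xi> \<partial>\<nu>) = - (?e x \<xi> * psi \<nu> \<xi>)" by simp
    qed
    finally show ?thesis .
  qed
  define E where "E h = (\<integral>\<xi>. cmod ((exp (- of_real h * psi \<nu> \<xi>) - 1) / of_real h + psi \<nu> \<xi>) \<partial>M)" for h :: real
  have quot_le: "cmod ((exp (- of_real h * psi \<nu> \<xi>) - 1) / of_real h + psi \<nu> \<xi>)
      \<le> 2 * ((\<integral>z. rho z \<partial>\<nu>) * (2 + norm \<xi>))" if "0 < h" for h \<xi>
  proof -
    have "cmod (exp (- (of_real h * psi \<nu> \<xi>)) - 1) \<le> cmod (of_real h * psi \<nu> \<xi>)"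
      using that Re_psi_nonneg[of \<xi>] by (intro norm_exp_minus_1_le) simp
    then have "cmod ((exp (- of_real h * psi \<nu> \<xi>) - 1) / of_real h) \<le> cmod (psi \<nu> \<xi>)"
      using that by (simp add: norm_divide norm_mult field_simps)
    then show ?thesis
      using norm_triangle_ineq[of "(exp (- of_real h * psi \<nu> \<xi>) - 1) / of_real h" "psi \<nu> \<xi>"]
        norm_psi_le[of \<xi>] by (simp add: mult.commute)
  qed
  have int_quot: "integrable M (\<lambda>\<xi>. (exp (- of_real h * psi \<nu> \<xi>) - 1) / of_real h + psi \<nu> \<xi>)" if "0 < h" for h :: real
    by (rule Bochner_Integration.integrable_bound[OF integrable_mult_right[OF int_psi, of 2]])
       (use quot_le[OF that] in \<open>auto intro!: AE_I2 order_trans[OF _ abs_ge_self]\<close>)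
  have E_lim: "(E \<longlongrightarrow> 0) (at_right 0)"
  proof (rule tendsto_at_right_sequentially[of 0 1])
    fix S :: "nat \<Rightarrow> real"
    assume S: "\<And>n. 0 < S n" "S \<longlonglongrightarrow> 0"
    have "(\<lambda>n. \<integral>\<xi>. cmod ((exp (- of_real (S n) * psi \<nu> \<xi>) - 1) / of_real (S n) + psi \<nu> \<xi>) \<partial>M) \<longlonglongrightarrow> (\<integral>\<xi>. 0 \<partial>M)"
    proof (rule integral_dominated_convergence[where w = "\<lambda>\<xi>. 2 * ((\<integral>z. rho z \<partial>\<nu>) * (2 + norm \<xi>))"])
      show "integrable M (\<lambda>\<xi>. 2 * ((\<integral>z. rho z \<partial>\<nu>) * (2 + norm \<xi>)))"
        by (intro integrable_mult_right int_psi)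
      have "(\<lambda>n. (exp (- of_real (S n) * psi \<nu> \<xi>) - 1) / of_real (S n) + psi \<nu> \<xi>) \<longlonglongrightarrow> - psi \<nu> \<xi> + psi \<nu> \<xi>" for \<xi>
        by (intro tendsto_add exp_difference_quotient S tendsto_const)
      then show "AE \<xi> in M. (\<lambda>n. cmod ((exp (- of_real (S n) * psi \<nu> \<xi>) - 1) / of_real (S n) + psi \<nu> \<xi>)) \<longlonglongrightarrow> 0"
        by (intro AE_I2 tendsto_norm_zero) simp
      show "AE \<xi> in M. norm (cmod ((exp (- of_real (S n) * psi \<nu> \<xi>) - 1) / of_real (S n) + psi \<nu> \<xi>))
          \<le> 2 * ((\<integral>z. rho z \<partial>\<nu>) * (2 + norm \<xi>))" for n
        using quot_le[OF S(1)] by simp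
    qed measurable
    then show "(\<lambda>n. E (S n)) \<longlonglongrightarrow> 0" by (simp add: E_def)
  qed simp
  have bound: "\<bar>(semigroup_op p h g x - g x) / h - levy_op \<nu> g x\<bar> \<le> B * E h" if h: "0 < h" for h x
  proof -
    let ?q = "\<lambda>\<xi>. (exp (- of_real h * psi \<nu> \<xi>) - 1) / of_real h + psi \<nu> \<xi>"
    have "complex_of_real ((semigroup_op p h g x - g x) / h - levy_op \<nu> g x)
      = ((\<integral>\<xi>. ?e x \<xi> * exp (- of_real h * psi \<nu> \<xi>) \<partial>M) - (\<integral>\<xi>. ?e x \<xi> \<partial>M)) / of_real h
          - (\<integral>\<xi>. - (?e x \<xi> * psi \<nu> \<xi>) \<partial>M)"
      using h by (simp only: of_real_diff of_real_divide Pt[OF less_imp_le[OF h]] A g)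
    also have "\<dots> = (\<integral>\<xi>. (?e x \<xi> * exp (- of_real h * psi \<nu> \<xi>) - ?e x \<xi>) / of_real h
          - - (?e x \<xi> * psi \<nu> \<xi>) \<partial>M)"
      using h int_Pt[of h x] int_e[of x] int_epsi[of x]
      by (subst Bochner_Integration.integral_diff) (auto intro!: integrable_divide)
    also have "\<dots> = (\<integral>\<xi>. ?e x \<xi> * ?q \<xi> \<partial>M)"
      by (intro Bochner_Integration.integral_cong) (simp_all add: algebra_simps diff_divide_distrib)
    finally have "\<bar>(semigroup_op p h g x - g x) / h - levy_op \<nu> g x\<bar> = cmod (\<integral>\<xi>. ?e x \<xi> * ?q \<xi> \<partial>M)"
      by (metis norm_of_real)
    also have "\<dots> \<le> (\<integral>\<xi>. B * cmod (?q \<xi>) \<partial>M)"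
    proof (rule Bochner_Integration.integral_norm_bound_integral)
      show "integrable M (\<lambda>\<xi>. B * cmod (?q \<xi>))"
        by (intro integrable_mult_right integrable_norm int_quot h)
      show *: "norm (?e x \<xi> * ?q \<xi>) \<le> B * cmod (?q \<xi>)" for \<xi>
        unfolding norm_mult[of "?e x \<xi>"] by (intro mult_right_mono norm_e) simp
      show "integrable M (\<lambda>\<xi>. ?e x \<xi> * ?q \<xi>)"
        by (rule Bochner_Integration.integrable_bound[OF \<open>integrable M (\<lambda>\<xi>. B * cmod (?q \<xi>))\<close>])
           (use * in \<open>auto intro!: AE_I2 order_trans[OF _ abs_ge_self] simp del: norm_mult\<close>)
    qed
    finally show ?thesis by (simp add: E_def)
  qed
  have "uniform_limit UNIV (\<lambda>t x. (semigroup_op p t g x - g x) / t) (levy_op \<nu> g) (at_right 0)"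
  proof (rule uniform_limitI)
    fix e :: real assume "e > 0"
    have "((\<lambda>h. B * E h) \<longlongrightarrow> B * 0) (at_right 0)" by (intro tendsto_intros E_lim)
    then have "eventually (\<lambda>h. B * E h < e) (at_right 0)"
      using \<open>e > 0\<close> by (intro order_tendstoD) auto
    moreover have "eventually (\<lambda>h::real. 0 < h) (at_right 0)" by (rule eventually_at_right_less)
    ultimately show "eventually (\<lambda>t. \<forall>x\<in>UNIV. dist ((semigroup_op p t g x - g x) / t) (levy_op \<nu> g x) < e) (at_right 0)"
      by eventually_elim (use bound in \<open>auto simp: dist_real_def intro: le_less_trans\<close>)
  qed
  then show ?thesis using assms by (simp add: gen_def)
qed

end

section \<open>Gaussian mollification\<close>

definition gauss :: "real ^ 'd::finite \<Rightarrow> real" where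
  "gauss x = exp (- (norm x)\<^sup>2 / 2)"

lemma gauss_pos [simp]: "0 < gauss x" and gauss_nonneg [simp]: "0 \<le> gauss x"
  by (auto simp: gauss_def)

lemma gauss_measurable [measurable]: "gauss \<in> borel_measurable borel"
  unfolding gauss_def by measurable

lemma gauss_prod: "gauss x = (\<Prod>b\<in>Basis. exp (- (x \<bullet> b)\<^sup>2 / 2))"
proof -
  have "(norm x)\<^sup>2 = (\<Sum>b\<in>Basis. (x \<bullet> b)\<^sup>2)"
    unfolding power2_norm_eq_inner by (subst euclidean_inner) (simp add: power2_eq_square)
  then show ?thesis
    by (simp add: gauss_def exp_sum[symmetric] sum_negf sum_divide_distrib)
qed

lemma integrable_gauss: "integrable lborel (gauss :: real ^ 'd::finite \<Rightarrow> real)"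
proof (rule integrableI_bounded)
  have "integrable lborel (\<lambda>u::real. sqrt (2 * pi) * (std_normal_density u * u ^ 0))"
    by (intro integrable_mult_right integrable_std_normal_moment)
  then have "integrable lborel (\<lambda>u::real. exp (- u\<^sup>2 / 2))"
    by (simp add: normal_density_def)
  then have "(\<integral>\<^sup>+u. ennreal (exp (- u\<^sup>2 / 2)) \<partial>lborel) < \<infinity>"
    by (simp add: integrable_iff_bounded)
  moreover have "(\<integral>\<^sup>+x. ennreal (gauss (x :: real ^ 'd)) \<partial>lborel)
      = (\<Prod>b\<in>(Basis :: (real ^ 'd) set). \<integral>\<^sup>+u. ennreal (exp (- u\<^sup>2 / 2)) \<partial>lborel)"
    by (subst nn_integral_lborel_prod[symmetric]) (auto simp: gauss_prod prod_ennreal)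
  ultimately show "(\<integral>\<^sup>+x. ennreal (norm (gauss (x :: real ^ 'd))) \<partial>lborel) < \<infinity>"
    by (simp add: power_less_top_ennreal)
qed measurable

lemma gauss_integral_pos: "0 < (\<integral>u. gauss (u :: real ^ 'd::finite) \<partial>lborel)"
proof -
  have "(\<integral>u. gauss (u :: real ^ 'd) \<partial>lborel) \<noteq> 0"
  proof
    assume "(\<integral>u. gauss (u :: real ^ 'd) \<partial>lborel) = 0"
    then have "AE u in lborel. gauss (u :: real ^ 'd) = 0"
      using integrable_gauss by (subst (asm) integral_nonneg_eq_0_iff_AE) auto
    then have "AE u in (lborel :: (real ^ 'd) measure). False"
      by eventually_elim (metis gauss_pos less_irrefl)
    then have "emeasure (lborel :: (real ^ 'd) measure) UNIV = 0"
      by (simp add: AE_iff_null null_sets_def)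
    then show False by (simp add: emeasure_lborel_UNIV)
  qed
  moreover have "0 \<le> (\<integral>u. gauss (u :: real ^ 'd) \<partial>lborel)"
    by (intro integral_nonneg_AE) auto
  ultimately show ?thesis by linarith
qed

text \<open>
  The measure is the law of a vector with independent standard normal coordinates; both its
  characteristic function and its first moment reduce to one dimension.
\<close>

lemma gauss_char:
  obtains M :: "(real ^ 'd::finite) measure"
  where "prob_space M" "sets M = sets borel" "integrable M norm"
    "\<And>x. (\<integral>\<xi>. iexp (x \<bullet> \<xi>) \<partial>M) = of_real (gauss x)"
proof -
  define N where "N = (\<lambda>_ :: real ^ 'd. std_normal_distribution)"
  interpret std: prob_space std_normal_distribution
    using real_dist_normal_dist by (simp add: real_distribution_def)
  interpret N: product_prob_space N Basis
    unfolding N_def by unfold_locales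
  define \<Phi> where "\<Phi> f = (\<Sum>b\<in>Basis. f b *\<^sub>R b)" for f :: "real ^ 'd \<Rightarrow> real"
  have \<Phi> [measurable]: "\<Phi> \<in> measurable (PiM Basis N) borel"
    unfolding \<Phi>_def N_def by measurable
  define M where "M = distr (PiM Basis N) borel \<Phi>"
  have 1: "prob_space M"
    unfolding M_def by (rule prob_space.prob_space_distr[OF prob_space_PiM \<Phi>]) (simp add: N_def std.prob_space_axioms)
  have 2: "sets M = sets borel" by (simp add: M_def)
  have inner: "x \<bullet> \<Phi> f = (\<Sum>b\<in>Basis. f b * (x \<bullet> b))" for x f
    by (simp add: \<Phi>_def inner_sum_right)
  have comp: "integrable (PiM Basis N) (\<lambda>f. \<bar>f b\<bar>)" if b: "b \<in> Basis" for b
  proof -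
    have "integrable std_normal_distribution (\<lambda>u. \<bar>u ^ 1\<bar>)"
      by (intro integrable_abs integrable_std_normal_distribution_moment)
    then have "integrable (distr (PiM Basis N) (N b) (\<lambda>f. f b)) (\<lambda>u. \<bar>u\<bar>)"
      by (subst distr_PiM_component) (auto simp: N_def std.prob_space_axioms b)
    then show ?thesis
      by (subst (asm) integrable_distr_eq) (auto simp: N_def b intro!: measurable_component_singleton)
  qed
  have "integrable (PiM Basis N) (\<lambda>f. norm (\<Phi> f))"
  proof (rule Bochner_Integration.integrable_bound)
    show "integrable (PiM Basis N) (\<lambda>f. \<Sum>b\<in>Basis. \<bar>f b\<bar>)"
      using comp by (intro Bochner_Integration.integrable_sum) auto
    have "norm (\<Phi> f) \<le> (\<Sum>b\<in>Basis. \<bar>f b\<bar>)" for f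
      unfolding \<Phi>_def by (intro order_trans[OF norm_sum] sum_mono) simp
    then show "AE f in PiM Basis N. norm (norm (\<Phi> f)) \<le> norm (\<Sum>b\<in>Basis. \<bar>f b\<bar>)"
      by (auto intro!: AE_I2 order_trans[OF _ abs_ge_self])
  qed measurable
  then have 3: "integrable M norm"
    unfolding M_def by (subst integrable_distr_eq) auto
  have 4: "(\<integral>\<xi>. iexp (x \<bullet> \<xi>) \<partial>M) = of_real (gauss x)" for x
  proof -
    have "(\<integral>\<xi>. iexp (x \<bullet> \<xi>) \<partial>M) = (\<integral>f. iexp (x \<bullet> \<Phi> f) \<partial>PiM Basis N)"
      unfolding M_def by (rule integral_distr) measurable
    also have "\<dots> = (\<integral>f. (\<Prod>b\<in>Basis. iexp ((x \<bullet> b) * f b)) \<partial>PiM Basis N)"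
      by (simp add: inner exp_sum sum_distrib_left mult.commute)
    also have "\<dots> = (\<Prod>b\<in>Basis. \<integral>u. iexp ((x \<bullet> b) * u) \<partial>N b)"
      by (rule N.product_integral_prod)
         (auto simp: N_def intro!: std.integrable_const_bound[of _ 1])
    also have "\<dots> = (\<Prod>b\<in>Basis. of_real (exp (- (x \<bullet> b)\<^sup>2 / 2)))"
      using fun_cong[OF char_std_normal_distribution] by (simp add: char_def N_def)
    finally show ?thesis by (simp add: gauss_prod)
  qed
  show ?thesis using that[OF 1 2 3 4] .
qed

text \<open>
  The averaging variable is scaled inside \<open>h\<close>, so the weight does not depend on \<open>n\<close>: Hoelder
  bounds are inherited by averaging translates, and convergence is dominated by the weight.
\<close>

definition mollify :: "nat \<Rightarrow> (real ^ 'd::finite \<Rightarrow> real) \<Rightarrow> real ^ 'd \<Rightarrow> real" where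
  "mollify n h x = (\<integral>u. h (x - u /\<^sub>R real (Suc n)) * gauss u \<partial>lborel) / (\<integral>u. gauss (u :: real ^ 'd) \<partial>lborel)"

lemma integrable_mollify:
  fixes h :: "real ^ 'd::finite \<Rightarrow> real"
  assumes "h \<in> borel_measurable borel" "\<And>x. \<bar>h x\<bar> \<le> B"
  shows "integrable lborel (\<lambda>u. h (x - u /\<^sub>R real (Suc n)) * gauss u)"
proof (rule Bochner_Integration.integrable_bound[OF integrable_mult_right[OF integrable_gauss, of B]])
  note [measurable] = assms(1)
  show "(\<lambda>u. h (x - u /\<^sub>R real (Suc n)) * gauss u) \<in> borel_measurable lborel" by measurable
  show "AE u in lborel. norm (h (x - u /\<^sub>R real (Suc n)) * gauss u) \<le> norm (B * gauss u)"
    using assms(2) by (auto simp: abs_mult intro!: AE_I2 mult_right_mono order_trans[OF _ abs_ge_self])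
qed

lemma mollify_hoelder:
  fixes h :: "real ^ 'd::finite \<Rightarrow> real"
  assumes "hoelder K b h" "h \<in> borel_measurable borel" "\<And>x. \<bar>h x\<bar> \<le> B"
  shows "hoelder K b (mollify n h)"
  unfolding hoelder_def
proof (intro conjI allI)
  show "0 \<le> K" using assms by (simp add: hoelder_def)
  fix x y :: "real ^ 'd"
  let ?Z = "\<integral>u. gauss (u :: real ^ 'd) \<partial>lborel"
  note int = integrable_mollify[OF assms(2,3)]
  have "norm (\<integral>u. h (x - u /\<^sub>R real (Suc n)) * gauss u - h (y - u /\<^sub>R real (Suc n)) * gauss u \<partial>lborel)
      \<le> (\<integral>u. (K * rho (x - y) powr b) * gauss (u :: real ^ 'd) \<partial>lborel)"
  proof (intro Bochner_Integration.integral_norm_bound_integral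
        Bochner_Integration.integrable_diff int integrable_mult_right integrable_gauss)
    fix u :: "real ^ 'd"
    have "\<bar>h (x - u /\<^sub>R real (Suc n)) - h (y - u /\<^sub>R real (Suc n))\<bar> \<le> K * rho (x - y) powr b"
      using assms(1)[unfolded hoelder_def, THEN conjunct2, rule_format,
          of "x - u /\<^sub>R real (Suc n)" "y - u /\<^sub>R real (Suc n)"] by simp
    then show "norm (h (x - u /\<^sub>R real (Suc n)) * gauss u - h (y - u /\<^sub>R real (Suc n)) * gauss u)
        \<le> (K * rho (x - y) powr b) * gauss u"
      unfolding left_diff_distrib[symmetric] by (simp add: abs_mult mult_right_mono)
  qed
  also have "\<dots> = K * rho (x - y) powr b * ?Z" by (rule integral_mult_right_zero)
  finally have "\<bar>mollify n h x * ?Z - mollify n h y * ?Z\<bar> \<le> K * rho (x - y) powr b * ?Z"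
    using int gauss_integral_pos[where 'd = 'd] by (simp add: mollify_def)
  then show "\<bar>mollify n h x - mollify n h y\<bar> \<le> K * rho (x - y) powr b"
    using gauss_integral_pos[where 'd = 'd] by (simp add: left_diff_distrib[symmetric] abs_mult)
qed

text \<open>
  After the substitution \<open>y = x - u / (n + 1)\<close> the kernel becomes a Gaussian in \<open>x - y\<close>, that is, an
  integral of characters. Exchanging the integrals turns the coefficient \<open>c\<close> into the Fourier transform
  of \<open>h\<close>, which is bounded since \<open>h\<close> is integrable.
\<close>

lemma mollify_fourier_rep:
  fixes h :: "real ^ 'd::finite \<Rightarrow> real"
  assumes h: "integrable lborel h" "h \<in> borel_measurable borel"
  shows "fourier_rep (mollify n h)"
proof -
  obtain M :: "(real ^ 'd) measure" where M: "prob_space M" "sets M = sets borel" "integrable M norm"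
    "\<And>x. (\<integral>\<xi>. iexp (x \<bullet> \<xi>) \<partial>M) = of_real (gauss x)"
    using gauss_char[where 'd = 'd] by blast
  note [measurable] = h(2)
  note [measurable_cong] = M(2)
  interpret M: prob_space M by (rule M)
  define m where "m = real (Suc n)"
  have m: "0 < m" by (simp add: m_def)
  define Z where "Z = (\<integral>u. gauss (u :: real ^ 'd) \<partial>lborel)"
  define M' where "M' = distr M borel (\<lambda>\<xi>. m *\<^sub>R \<xi>)"
  define c where "c \<xi> = of_real (m ^ CARD('d) / Z) * (\<integral>y. of_real (h y) * iexp (- (y \<bullet> \<xi>)) \<partial>lborel)" for \<xi> :: "real ^ 'd"
  have [measurable]: "(\<lambda>\<xi>. m *\<^sub>R \<xi>) \<in> measurable M borel" by measurable
  interpret M': prob_space M' unfolding M'_def by (rule M.prob_space_distr) measurable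
  have sets_M': "sets M' = sets borel" by (simp add: M'_def)
  note [measurable_cong] = sets_M'
  have "integrable M (\<lambda>\<xi>. norm (m *\<^sub>R \<xi>))" using M(3) by simp
  then have norm_M': "integrable M' norm"
    unfolding M'_def by (subst integrable_distr_eq) auto
  have char_M': "(\<integral>\<xi>. iexp (x \<bullet> \<xi>) \<partial>M') = of_real (gauss (m *\<^sub>R x))" for x
    unfolding M'_def M(4)[symmetric] by (subst integral_distr) auto
  have c_meas: "c \<in> borel_measurable borel"
    unfolding c_def by (intro borel_measurable_times lborel.borel_measurable_lebesgue_integral) measurable
  have c_bound: "cmod (c \<xi>) \<le> m ^ CARD('d) / Z * (\<integral>y. \<bar>h y\<bar> \<partial>lborel)" for \<xi>
  proof -
    have "cmod (\<integral>y. of_real (h y) * iexp (- (y \<bullet> \<xi>)) \<partial>lborel) \<le> (\<integral>y. cmod (of_real (h y) * iexp (- (y \<bullet> \<xi>))) \<partial>lborel)"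
      by (rule integral_norm_bound)
    also have "\<dots> = (\<integral>y. \<bar>h y\<bar> \<partial>lborel)" by (simp add: norm_mult)
    finally show ?thesis
      using m gauss_integral_pos[where 'd = 'd] unfolding c_def Z_def norm_mult
      by (intro mult_mono) (auto simp: norm_divide norm_power)
  qed
  have rep: "complex_of_real (mollify n h x) = (\<integral>\<xi>. c \<xi> * iexp (x \<bullet> \<xi>) \<partial>M')" for x
  proof -
    interpret pair_sigma_finite lborel M' ..
    let ?k = "\<lambda>y \<xi>. of_real (h y) * iexp ((x - y) \<bullet> \<xi>)"
    have "integrable (lborel \<Otimes>\<^sub>M M') (\<lambda>(y, \<xi>). ?k y \<xi>)"
    proof (rule Fubini_integrable)
      show "integrable lborel (\<lambda>y. \<integral>\<xi>. norm (case (y, \<xi>) of (y, \<xi>) \<Rightarrow> ?k y \<xi>) \<partial>M')"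
        using h(1) M'.prob_space by (simp add: norm_mult)
      show "AE y in lborel. integrable M' (\<lambda>\<xi>. case (y, \<xi>) of (y, \<xi>) \<Rightarrow> ?k y \<xi>)"
        by (intro AE_I2) (auto intro!: M'.integrable_const_bound simp: norm_mult)
    qed measurable
    note Fub = Fubini_integral[OF this]
    have "(\<integral>y. h y * gauss (m *\<^sub>R (x - y)) \<partial>lborel)
        = \<bar>- (1 / m)\<bar> ^ CARD('d) * (\<integral>u. h (x + (- (1 / m)) *\<^sub>R u) * gauss (m *\<^sub>R (x - (x + (- (1 / m)) *\<^sub>R u))) \<partial>lborel)"
      using m by (subst lborel_affine[of "- (1 / m)" x]) (simp_all add: integral_density integral_distr)
    also have "\<dots> = (\<integral>u. h (x - u /\<^sub>R m) * gauss u \<partial>lborel) / m ^ CARD('d)"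
      using m by (simp add: power_one_over divide_inverse power_inverse)
    finally have "mollify n h x = m ^ CARD('d) / Z * (\<integral>y. h y * gauss (m *\<^sub>R (x - y)) \<partial>lborel)"
      using m by (simp add: mollify_def m_def[symmetric] Z_def del: of_nat_Suc)
    then have "complex_of_real (mollify n h x)
        = of_real (m ^ CARD('d) / Z) * (\<integral>y. complex_of_real (h y * gauss (m *\<^sub>R (x - y))) \<partial>lborel)"
      by (simp only: of_real_mult[of "m ^ CARD('d) / Z"] integral_complex_of_real)
    also have "\<dots> = of_real (m ^ CARD('d) / Z) * (\<integral>y. \<integral>\<xi>. ?k y \<xi> \<partial>M' \<partial>lborel)"
      by (simp only: of_real_mult char_M'[symmetric] integral_mult_right_zero)
    also have "\<dots> = of_real (m ^ CARD('d) / Z) * (\<integral>\<xi>. \<integral>y. ?k y \<xi> \<partial>lborel \<partial>M')"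
      using Fub by simp
    also have "\<dots> = (\<integral>\<xi>. of_real (m ^ CARD('d) / Z) * (\<integral>y. ?k y \<xi> \<partial>lborel) \<partial>M')"
      by (rule integral_mult_right_zero[symmetric])
    also have "\<dots> = (\<integral>\<xi>. c \<xi> * iexp (x \<bullet> \<xi>) \<partial>M')"
    proof (intro Bochner_Integration.integral_cong refl)
      fix \<xi>
      have "?k y \<xi> = of_real (h y) * iexp (- (y \<bullet> \<xi>)) * iexp (x \<bullet> \<xi>)" for y
        by (simp add: inner_diff_left right_diff_distrib exp_diff exp_minus divide_inverse)
      then have "(\<integral>y. ?k y \<xi> \<partial>lborel) = (\<integral>y. of_real (h y) * iexp (- (y \<bullet> \<xi>)) \<partial>lborel) * iexp (x \<bullet> \<xi>)"
        by (simp only: integral_mult_left_zero)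
      then show "of_real (m ^ CARD('d) / Z) * (\<integral>y. ?k y \<xi> \<partial>lborel) = c \<xi> * iexp (x \<bullet> \<xi>)"
        by (simp only: c_def mult.assoc)
    qed
    finally show ?thesis .
  qed
  show ?thesis
    unfolding fourier_rep_def
    using M'.finite_measure_axioms sets_M' norm_M' c_meas c_bound rep by blast
qed

text \<open>
  Lipschitz with constant at most \<open>1\<close> for every \<open>n\<close>, so that multiplication by it costs only a fixed amount
  in the Hoelder constant.
\<close>

definition cutoff :: "nat \<Rightarrow> real ^ 'd::finite \<Rightarrow> real" where
  "cutoff n x = max 0 (1 - norm x / real (Suc n))"

lemma cutoff_bounds: "0 \<le> cutoff n x" "cutoff n x \<le> 1"
  by (auto simp: cutoff_def)

lemma cutoff_mult_bound: "\<bar>a\<bar> \<le> B \<Longrightarrow> \<bar>a * cutoff n x\<bar> \<le> B"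
  using mult_left_le[of "cutoff n x" "\<bar>a\<bar>"] cutoff_bounds[of n x] by (simp add: abs_mult)

lemma cutoff_measurable [measurable]: "cutoff n \<in> borel_measurable borel"
  unfolding cutoff_def by measurable

lemma cutoff_lipschitz: "\<bar>cutoff n x - cutoff n y\<bar> \<le> rho (x - y)"
proof -
  have "\<bar>cutoff n x - cutoff n y\<bar> \<le> \<bar>norm x / real (Suc n) - norm y / real (Suc n)\<bar>"
    unfolding cutoff_def by linarith
  also have "\<dots> = \<bar>norm x - norm y\<bar> / real (Suc n)" by (simp add: diff_divide_distrib[symmetric])
  also have "\<dots> \<le> norm (x - y) / 1"
    by (intro frac_le norm_triangle_ineq3) auto
  finally have "\<bar>cutoff n x - cutoff n y\<bar> \<le> norm (x - y)" by simp
  moreover have "\<bar>cutoff n x - cutoff n y\<bar> \<le> 1"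
    using cutoff_bounds[of n x] cutoff_bounds[of n y] by linarith
  ultimately show ?thesis by (simp add: rho_def)
qed

lemma hoelder_cutoff:
  fixes g :: "real ^ 'd::finite \<Rightarrow> real"
  assumes "hoelder K b g" "\<And>x. \<bar>g x\<bar> \<le> B" "b \<le> 1"
  shows "hoelder (K + B) b (\<lambda>x. g x * cutoff n x)"
  unfolding hoelder_def
proof (intro conjI allI)
  have K: "0 \<le> K" using assms by (simp add: hoelder_def)
  have B: "0 \<le> B" using order_trans[OF abs_ge_zero assms(2)] .
  show "0 \<le> K + B" using K B by simp
  fix x y :: "real ^ 'd"
  have "\<bar>cutoff n x - cutoff n y\<bar> \<le> rho (x - y) powr b"
    using cutoff_lipschitz[of n x y] rho_powr_antimono[OF assms(3), of "x - y"] by simp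
  then have "\<bar>g y\<bar> * \<bar>cutoff n x - cutoff n y\<bar> \<le> B * rho (x - y) powr b"
    using assms(2) B by (intro mult_mono) auto
  moreover have "\<bar>g x - g y\<bar> * cutoff n x \<le> K * rho (x - y) powr b * 1"
    using assms(1) cutoff_bounds K by (intro mult_mono) (auto simp: hoelder_def)
  moreover have "g x * cutoff n x - g y * cutoff n y = (g x - g y) * cutoff n x + g y * (cutoff n x - cutoff n y)"
    by (simp add: algebra_simps)
  then have "\<bar>g x * cutoff n x - g y * cutoff n y\<bar> \<le> \<bar>g x - g y\<bar> * cutoff n x + \<bar>g y\<bar> * \<bar>cutoff n x - cutoff n y\<bar>"
    using cutoff_bounds(1)[of n x] abs_triangle_ineq[of "(g x - g y) * cutoff n x" "g y * (cutoff n x - cutoff n y)"]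
    by (simp add: abs_mult)
  ultimately show "\<bar>g x * cutoff n x - g y * cutoff n y\<bar> \<le> (K + B) * rho (x - y) powr b"
    by (simp add: distrib_right)
qed

lemma integrable_cutoff:
  fixes g :: "real ^ 'd::finite \<Rightarrow> real"
  assumes "g \<in> borel_measurable borel" "\<And>x. \<bar>g x\<bar> \<le> B"
  shows "integrable lborel (\<lambda>x. g x * cutoff n x)"
proof -
  note [measurable] = assms(1)
  have "integrable lborel (\<lambda>x :: real ^ 'd. B * indicator (cball 0 (real (Suc n))) x)"
    by (intro integrable_mult_right integrable_real_indicator) (simp_all add: emeasure_lborel_cball_finite[unfolded infinity_ennreal_def] del: of_nat_Suc)
  then show ?thesis
  proof (rule Bochner_Integration.integrable_bound)
  have "\<bar>g x * cutoff n x\<bar> \<le> B * indicator (cball 0 (real (Suc n))) x" for x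
  proof (cases "x \<in> cball 0 (real (Suc n))")
    case True
    then show ?thesis
      using cutoff_mult_bound[OF assms(2)] by simp
  next
    case False
    then have "cutoff n x = 0" by (simp add: cutoff_def max_def divide_le_eq le_divide_eq)
    then show ?thesis using False by simp
  qed
  then show "AE x in lborel. norm (g x * cutoff n x) \<le> norm (B * indicator (cball 0 (real (Suc n))) x)"
    by (intro AE_I2) (metis abs_ge_self order_trans real_norm_def)
  qed measurable
qed

lemma mollify_cutoff_tendsto:
  fixes g :: "real ^ 'd::finite \<Rightarrow> real"
  assumes "g \<in> BUC"
  shows "(\<lambda>n. mollify n (\<lambda>y. g y * cutoff n y) x) \<longlonglongrightarrow> g x"
proof -
  note [measurable] = BUC_measurable[OF assms]
  obtain B where B: "\<And>x. \<bar>g x\<bar> \<le> B" using BUC_bound[OF assms] by blast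
  let ?Z = "\<integral>u. gauss (u :: real ^ 'd) \<partial>lborel"
  let ?h = "\<lambda>n u. g (x - u /\<^sub>R real (Suc n)) * cutoff n (x - u /\<^sub>R real (Suc n))"
  have inv0: "(\<lambda>n. inverse (real (Suc n))) \<longlonglongrightarrow> 0" by (rule LIMSEQ_inverse_real_of_nat)
  have lim: "(\<lambda>n. ?h n u) \<longlonglongrightarrow> g x" for u
  proof -
    have "(\<lambda>n. x - inverse (real (Suc n)) *\<^sub>R u) \<longlonglongrightarrow> x - 0 *\<^sub>R u"
      by (intro tendsto_intros inv0)
    then have arg: "(\<lambda>n. x - u /\<^sub>R real (Suc n)) \<longlonglongrightarrow> x" by simp
    have "isCont g x"
      using assms by (auto simp: BUC_def continuous_on_eq_continuous_at dest: uniformly_continuous_imp_continuous)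
    then have "(\<lambda>n. g (x - u /\<^sub>R real (Suc n))) \<longlonglongrightarrow> g x"
      using arg by (rule isCont_tendsto_compose)
    moreover have "(\<lambda>n. max 0 (1 - norm (x - u /\<^sub>R real (Suc n)) * inverse (real (Suc n)))) \<longlonglongrightarrow> max 0 (1 - norm x * 0)"
      by (intro tendsto_intros arg inv0)
    then have "(\<lambda>n. cutoff n (x - u /\<^sub>R real (Suc n))) \<longlonglongrightarrow> 1"
      by (simp add: cutoff_def divide_inverse)
    ultimately have "(\<lambda>n. ?h n u) \<longlonglongrightarrow> g x * 1" by (rule tendsto_mult)
    then show ?thesis by simp
  qed
  have "(\<lambda>n. \<integral>u. ?h n u * gauss u \<partial>lborel) \<longlonglongrightarrow> (\<integral>u. g x * gauss (u :: real ^ 'd) \<partial>lborel)"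
  proof (rule integral_dominated_convergence[where w = "\<lambda>u :: real ^ 'd. B * gauss u"])
    show "integrable lborel (\<lambda>u :: real ^ 'd. B * gauss u)" by (intro integrable_mult_right integrable_gauss)
    show "AE u in lborel. (\<lambda>n. ?h n u * gauss u) \<longlonglongrightarrow> g x * gauss u"
      by (intro AE_I2 tendsto_mult_right lim)
    have "\<bar>?h n u * gauss u\<bar> \<le> B * gauss u" for n u
      unfolding abs_mult[of "?h n u"] abs_of_nonneg[OF gauss_nonneg]
      by (intro mult_right_mono cutoff_mult_bound[OF B] gauss_nonneg)
    then show "AE u in lborel. norm (?h n u * gauss u) \<le> B * gauss u" for n
      by (intro AE_I2) (simp only: real_norm_def)
  qed measurable
  then have "(\<lambda>n. (\<integral>u. ?h n u * gauss u \<partial>lborel) / ?Z) \<longlonglongrightarrow> (\<integral>u. g x * gauss (u :: real ^ 'd) \<partial>lborel) / ?Z"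
    using gauss_integral_pos[where 'd = 'd] by (intro tendsto_divide tendsto_const) auto
  also have "(\<integral>u. g x * gauss (u :: real ^ 'd) \<partial>lborel) / ?Z = g x"
    using gauss_integral_pos[where 'd = 'd] by simp
  finally show ?thesis by (simp add: mollify_def)
qed

lemma fourier_approximation:
  assumes "g \<in> BUC" "hoelder K b g" "b \<le> 1"
  obtains F L where "\<And>n. hoelder L b (F n)" "\<And>n. fourier_rep (F n)" "\<And>x. (\<lambda>n. F n x) \<longlonglongrightarrow> g x"
proof -
  note [measurable] = BUC_measurable[OF assms(1)]
  obtain B where B: "\<And>x. \<bar>g x\<bar> \<le> B" using BUC_bound[OF assms(1)] by blast
  have bd: "\<bar>g x * cutoff n x\<bar> \<le> B" for n x
    by (rule cutoff_mult_bound[OF B])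
  show ?thesis
  proof (rule that[of "K + B" "\<lambda>n. mollify n (\<lambda>y. g y * cutoff n y)"])
    show "hoelder (K + B) b (mollify n (\<lambda>y. g y * cutoff n y))" for n
      by (rule mollify_hoelder[OF hoelder_cutoff[OF assms(2) B assms(3)] _ bd]) measurable
    show "fourier_rep (mollify n (\<lambda>y. g y * cutoff n y))" for n
      by (intro mollify_fourier_rep integrable_cutoff[OF _ B]) measurable
    show "(\<lambda>n. mollify n (\<lambda>y. g y * cutoff n y) x) \<longlonglongrightarrow> g x" for x
      by (rule mollify_cutoff_tendsto[OF assms(1)])
  qed
qed

section \<open>The generator on Hoelder functions\<close>

context levy_semigroup
begin

text \<open>
  Increments are used because they are bounded by \<open>L\<close> uniformly in \<open>n\<close>, while the values of \<open>F n\<close> are not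
  assumed to be.
\<close>

lemma semigroup_op_tendsto:
  assumes "\<And>n. hoelder L b (F n)" "0 < b" "g \<in> BUC" "\<And>x. (\<lambda>n. F n x) \<longlonglongrightarrow> g x" "0 \<le> t"
  shows "(\<lambda>n. semigroup_op p t (F n) x) \<longlonglongrightarrow> semigroup_op p t g x"
proof -
  note [measurable] = BUC_measurable[OF assms(3)] BUC_measurable[OF hoelder_BUC[OF assms(1,2)]]
  note [measurable_cong] = sets_p[OF assms(5)]
  have incr: "semigroup_op p t f x - f x = (\<integral>y. f (x + y) - f x \<partial>p t)" if "f \<in> BUC" for f
    using that assms(5) by (simp add: semigroup_op_def integrable_shift integrable_const_p prob_p)
  have "(\<lambda>n. \<integral>y. F n (x + y) - F n x \<partial>p t) \<longlonglongrightarrow> (\<integral>y. g (x + y) - g x \<partial>p t)"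
  proof (rule integral_dominated_convergence[where w = "\<lambda>_. L"])
    show "integrable (p t) (\<lambda>_. L)" using assms(5) by (rule integrable_const_p)
    show "AE y in p t. (\<lambda>n. F n (x + y) - F n x) \<longlonglongrightarrow> g (x + y) - g x"
      by (intro AE_I2 tendsto_diff assms)
    have "\<bar>F n (x + y) - F n x\<bar> \<le> L" for n y
      using assms(1)[of n] mult_left_mono[OF rho_powr_le_1[of b y], of L] assms(2)
      unfolding hoelder_def by (smt (verit) add_diff_cancel_left')
    then show "AE y in p t. norm (F n (x + y) - F n x) \<le> L" for n by simp
  qed measurable
  then have "(\<lambda>n. semigroup_op p t (F n) x - F n x) \<longlonglongrightarrow> semigroup_op p t g x - g x"
    using incr[OF assms(3)] incr[OF hoelder_BUC[OF assms(1,2)]] by simp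
  from tendsto_add[OF this assms(4)[of x]] show ?thesis by simp
qed

lemma hoelder_increment_bound:
  assumes "hoelder L a f" "0 < a" "0 \<le> s"
  shows "\<bar>semigroup_op p s f x - f x\<bar> \<le> L * (\<integral>y. rho y powr a \<partial>p s)"
proof -
  have BUC: "f \<in> BUC" by (rule hoelder_BUC[OF assms(1,2)])
  have int: "integrable (p s) (\<lambda>y. rho y powr a)"
    using assms rho_powr_le_1[of a] by (intro integrable_bounded[where B = 1]) auto
  have "norm (\<integral>y. f (x + y) - f x \<partial>p s) \<le> (\<integral>y. L * rho y powr a \<partial>p s)"
  proof (intro Bochner_Integration.integral_norm_bound_integral
      integrable_increment_p BUC assms integrable_mult_right int)
    show "norm (f (x + y) - f x) \<le> L * rho y powr a" for y
      using assms(1) unfolding hoelder_def by (metis add_diff_cancel_left' real_norm_def)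
  qed
  then show ?thesis
    using assms BUC by (simp add: semigroup_op_def integrable_shift integrable_const_p prob_p)
qed

text \<open>
  For the approximants \<open>F n\<close> the mean value theorem compares \<open>P\<^sub>t (F n) x\<close> with its affine approximation,
  with an error determined by the common Hoelder constant \<open>L'\<close> of the functions \<open>A (F n)\<close>. As this error is
  independent of \<open>n\<close> and \<open>x\<close>, pointwise convergence in \<open>n\<close> already gives the uniform estimate for \<open>g\<close>.
\<close>

lemma generator_on_hoelder:
  assumes "g \<in> C0" "hoelder K b g" "b \<le> 1" "0 < c" "c < b" "integrable \<nu> (\<lambda>z. rho z powr c)"
  shows "has_generator_limit p g (levy_op \<nu> g)"
proof -
  have g: "g \<in> BUC" using assms(1) C0_subset_BUC by blast
  have b: "0 < b" "c \<le> b" "0 < b - c" using assms by auto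
  obtain F L where F: "\<And>n. hoelder L b (F n)" "\<And>n. fourier_rep (F n)" "\<And>x. (\<lambda>n. F n x) \<longlonglongrightarrow> g x"
    using fourier_approximation[OF g assms(2,3)] by metis
  note [measurable] = BUC_measurable[OF g]
  define L' where "L' = 2 * L * (\<integral>z. rho z powr c \<partial>\<nu>)"
  have AF: "hoelder L' (b - c) (levy_op \<nu> (F n))" for n
    unfolding L'_def using assms by (intro levy_op_hoelder F) auto
  have gen: "gen (F n) (levy_op \<nu> (F n))" for n
    by (intro fourier_gen F hoelder_BUC[OF F(1) b(1)] hoelder_BUC[OF AF b(3)])
  have A_lim: "(\<lambda>n. levy_op \<nu> (F n) x) \<longlonglongrightarrow> levy_op \<nu> g x" for x
    unfolding levy_op_def[of \<nu> g]
    by (rule levy_op_tendsto[OF assms(6) b(2,1) F(1)]) (auto intro!: tendsto_diff F)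
  have "uniform_limit UNIV (\<lambda>t x. (semigroup_op p t g x - g x) / t) (levy_op \<nu> g) (at_right 0)"
  proof (rule uniform_limitI)
    fix e :: real assume "e > 0"
    have "((\<lambda>t. \<integral> y. rho y powr (b - c) \<partial>p t) \<longlongrightarrow> rho (0 :: real ^ 'd) powr (b - c)) (at_right 0)"
      by (rule continuous_at_0[where B = 1 and g = "\<lambda>y. rho y powr (b - c)", OF continuous_rho_powr[OF b(3)]]) (use b rho_powr_le_1[of "b - c"] in auto)
    then have "((\<lambda>t. L' * (\<integral> y. rho y powr (b - c) \<partial>p t)) \<longlongrightarrow> L' * 0) (at_right 0)"
      by (intro tendsto_mult_left) simp
    then have "eventually (\<lambda>t. L' * (\<integral> y. rho y powr (b - c) \<partial>p t) < e / 2) (at_right 0)"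
      using \<open>e > 0\<close> by (intro order_tendstoD) auto
    then obtain d where d: "d > 0" "\<And>s. 0 < s \<Longrightarrow> s < d \<Longrightarrow> L' * (\<integral> y. rho y powr (b - c) \<partial>p s) < e / 2"
      unfolding eventually_at_right_field by auto
    have "dist ((semigroup_op p t g x - g x) / t) (levy_op \<nu> g x) < e" if t: "0 < t" "t < d" for t x
    proof -
      have "\<bar>semigroup_op p t (F n) x - (F n x + t * levy_op \<nu> (F n) x)\<bar> \<le> e / 2 * t" for n
      proof (rule semigroup_op_mvt[OF gen t(1), where q' = "\<lambda>_. levy_op \<nu> (F n) x"])
        show "((\<lambda>s. F n x + s * levy_op \<nu> (F n) x) has_real_derivative levy_op \<nu> (F n) x) (at s)" for s
          by (auto intro!: derivative_eq_intros)
        show "\<bar>semigroup_op p s (levy_op \<nu> (F n)) x - levy_op \<nu> (F n) x\<bar> \<le> e / 2" if "0 < s" "s < t" for s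
          using hoelder_increment_bound[OF AF b(3), of s n x] d(2)[of s] that t by simp
      qed simp
      moreover have "(\<lambda>n. \<bar>semigroup_op p t (F n) x - (F n x + t * levy_op \<nu> (F n) x)\<bar>)
          \<longlonglongrightarrow> \<bar>semigroup_op p t g x - (g x + t * levy_op \<nu> g x)\<bar>"
        using t by (intro tendsto_intros semigroup_op_tendsto[OF F(1) b(1) g F(3)] F(3) A_lim) auto
      ultimately have "\<bar>semigroup_op p t g x - (g x + t * levy_op \<nu> g x)\<bar> \<le> e / 2 * t"
        by (intro LIMSEQ_le_const2) auto
      moreover have "semigroup_op p t g x - (g x + t * levy_op \<nu> g x)
          = t * ((semigroup_op p t g x - g x) / t - levy_op \<nu> g x)"
        using t by (simp add: field_simps)
      ultimately have "t * dist ((semigroup_op p t g x - g x) / t) (levy_op \<nu> g x) \<le> t * (e / 2)"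
        using t by (simp add: abs_mult dist_real_def mult.commute)
      then have "dist ((semigroup_op p t g x - g x) / t) (levy_op \<nu> g x) \<le> e / 2"
        using t by (simp only: mult_le_cancel_left_pos)
      then show ?thesis using \<open>e > 0\<close> by linarith
    qed
    then show "eventually (\<lambda>t. \<forall>x\<in>UNIV. dist ((semigroup_op p t g x - g x) / t) (levy_op \<nu> g x) < e) (at_right 0)"
      unfolding eventually_at_right_field using d(1) by blast
  qed
  then show ?thesis
    using levy_op_C0[OF assms(1,2,4,5,6)] by (simp add: has_generator_limit_def)
qed

lemma iterated_generator:
  assumes "f \<in> C0" "hoelder K b f" "b \<le> 1" "0 < c" "integrable \<nu> (\<lambda>z. rho z powr c)"
    and "real k * c < b"
  shows "(generator_op p ^^ k) f \<in> C0 \<and> (\<exists>K. hoelder K (b - real k * c) ((generator_op p ^^ k) f))"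
  using assms(6)
proof (induction k)
  case 0
  then show ?case using assms by auto
next
  case (Suc k)
  let ?g = "(generator_op p ^^ k) f"
  have k: "real k * c < b" "c < b - real k * c" "b - real k * c \<le> 1"
  proof -
    have "0 \<le> real k * c" using assms(4) by simp
    moreover have "real (Suc k) * c = real k * c + c" by (simp add: distrib_right)
    ultimately show "real k * c < b" "c < b - real k * c" "b - real k * c \<le> 1"
      using Suc.prems assms(3,4) by linarith+
  qed
  then obtain K where K: "?g \<in> C0" "hoelder K (b - real k * c) ?g" using Suc.IH by auto
  have "generator_op p ?g = levy_op \<nu> ?g"
    by (intro generator_op_eq generator_on_hoelder[OF K k(3) assms(4) k(2) assms(5)])
  moreover have "levy_op \<nu> ?g \<in> C0"
    by (rule levy_op_C0[OF K assms(4) k(2) assms(5)])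
  moreover have "hoelder (2 * K * (\<integral>z. rho z powr c \<partial>\<nu>)) (b - real k * c - c) (levy_op \<nu> ?g)"
    using k assms(4) by (intro levy_op_hoelder K assms(5)) auto
  ultimately show ?case by (auto simp: algebra_simps)
qed

end

theorem theorem1:
  fixes \<nu> :: "(real ^ 'd::finite) measure"
    and p :: "real \<Rightarrow> (real ^ 'd) measure"
    and n :: nat and \<alpha> \<beta> C :: real
    and f :: "real ^ 'd \<Rightarrow> real"
  assumes "jump_measure \<nu>"
    and "convolution_semigroup p"
    and "\<And>t \<xi>. t \<ge> 0 \<Longrightarrow>
           (\<integral> x. iexp (\<xi> \<bullet> x) \<partial>p t) = exp (- complex_of_real t * psi \<nu> \<xi>)"
    and "n \<ge> 1"
    and "0 < \<alpha>" "\<alpha> < 1" "C \<ge> 1"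
    and "\<And>r \<theta>. r \<ge> 1 \<Longrightarrow> \<theta> > 1 \<Longrightarrow>
           psi_star \<nu> (r * \<theta>) \<le> C * r powr \<alpha> * psi_star \<nu> \<theta>"
    and "real n * \<alpha> < \<beta>" "\<beta> \<le> 1"
    and "f \<in> C0_Holder \<beta>"
  shows "(\<forall>k<n. (generator_op p ^^ k) f \<in> generator_domain p) \<and>
    uniform_limit UNIV
      (\<lambda>t x. (semigroup_op p t f x - (\<Sum>k<n. t ^ k / fact k * (generator_op p ^^ k) f x)) / t ^ n)
      (\<lambda>x. (generator_op p ^^ n) f x / fact n)
      (at_right 0)"
proof -
  interpret levy_semigroup p \<nu>
    using assms(1-3) by unfold_locales auto
  have n: "0 < real n" using assms(4) by simp
  have "\<alpha> < \<beta> / real n" using assms(9) n by (simp add: field_simps)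
  then obtain \<gamma> where \<gamma>: "\<alpha> < \<gamma>" "\<gamma> < \<beta> / real n" using dense by blast
  then have n\<gamma>: "real n * \<gamma> < \<beta>" using n by (simp add: field_simps)
  have "0 < \<beta>"
    using assms(9) mult_pos_pos[OF n assms(5)] by linarith
  then have "\<beta> / real n \<le> \<beta> / 1"
    using assms(4) by (intro divide_left_mono) auto
  with \<gamma> assms(5,10) have \<gamma>': "0 < \<gamma>" "\<gamma> \<le> 2" by auto
  have int: "integrable \<nu> (\<lambda>z. rho z powr \<gamma>)"
  proof (rule integrable_rho_powr[OF _ \<gamma>(1) \<gamma>'])
    \<comment> \<open>The scaling condition needs a reference point \<open>\<theta> > 1\<close>; the choice \<open>2\<close> is arbitrary.\<close>
    fix R :: real assume R: "2 \<le> R"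
    then show "psi_star \<nu> R \<le> (C * (1 / 2) powr \<alpha> * psi_star \<nu> 2) * R powr \<alpha>"
      using assms(8)[of "R / 2" 2] by (simp add: powr_mult[symmetric] mult_ac powr_divide)
  qed
  have f: "f \<in> C0" using assms(11) by (simp add: C0_Holder_def)
  obtain K where K: "hoelder K \<beta> f" using C0_Holder_imp_hoelder[OF assms(11) \<open>0 < \<beta>\<close>] .
  have lim: "has_generator_limit p ((generator_op p ^^ k) f) ((generator_op p ^^ Suc k) f)"
    and C0: "(generator_op p ^^ k) f \<in> C0" if "k < n" for k
  proof -
    have "real (Suc k) * \<gamma> \<le> real n * \<gamma>" using that \<gamma>' by (intro mult_right_mono) auto
    moreover have "real (Suc k) * \<gamma> = real k * \<gamma> + \<gamma>" by (simp add: distrib_right)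
    moreover have "0 \<le> real k * \<gamma>" using \<gamma>' by simp
    ultimately have k: "real k * \<gamma> < \<beta>" "\<gamma> < \<beta> - real k * \<gamma>" "\<beta> - real k * \<gamma> \<le> 1"
      using n\<gamma> \<gamma>' assms(10) by linarith+
    obtain K' where g: "(generator_op p ^^ k) f \<in> C0" "hoelder K' (\<beta> - real k * \<gamma>) ((generator_op p ^^ k) f)"
      using iterated_generator[OF f K assms(10) \<gamma>'(1) int k(1)] by blast
    show "(generator_op p ^^ k) f \<in> C0" by (rule g)
    have "has_generator_limit p ((generator_op p ^^ k) f) (levy_op \<nu> ((generator_op p ^^ k) f))"
      by (rule generator_on_hoelder[OF g k(3) \<gamma>'(1) k(2) int])
    then show "has_generator_limit p ((generator_op p ^^ k) f) ((generator_op p ^^ Suc k) f)"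
      by (simp add: generator_op_eq)
  qed
  have "uniform_limit UNIV
      (\<lambda>t x. (semigroup_op p t ((generator_op p ^^ 0) f) x - (\<Sum>k<n. t ^ k / fact k * (generator_op p ^^ k) f x)) / t ^ n)
      (\<lambda>x. (generator_op p ^^ n) f x / fact n) (at_right 0)"
    using f C0_subset_BUC lim C0
    by (intro taylor_expansion) (auto intro: gen_if_has_generator_limit simp del: funpow.simps)
  then show ?thesis
    using lim C0 by (auto simp: generator_domain_def)
qed

end
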